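(* Let $n\ge 1$ be an integer. If $E\subset\mathbb{T}^n$ is compact and $C(E)=0$, then there exists a function $f\in\mathcal{D}(\mathbb{D}^n)$ such that $$\lim_{z\to\zeta}\operatorname{Re} f(z)=\infty\quad\text{for every }\zeta\in E,$$ where the limit is taken over $z\in\mathbb{D}^n$, without restriction on the manner of approach.
   Context: Notation: $\mathbb{N}=\{0,1,2,\dots\}$; $\mathbb{D}$ is the open unit disc, $\mathbb{T}$ the unit circle, and $\mathbb{T}^n\subset\mathbb{C}^n$ is identified with $[0,2\pi)^n$ via $\theta\mapsto(e^{i\theta_1},\dots,e^{i\theta_n})$; $d\psi$ denotes normalized Lebesgue measure on $\mathbb{T}^n$. Dirichlet space: a multiple Fourier series $f(\theta)\sim\sum_{\alpha\in\mathbb{N}^n}a_\alpha e^{i(\alpha_1\theta_1+\cdots+\alpha_n\theta_n)}$ with coefficients $a_\alpha\in\mathbb{C}$ belongs to $\mathcal{D}(\mathbb{D}^n)$ if $\sum_{\alpha\in\mathbb{N}^n}(\alpha_1+1)\cdots(\alpha_n+1)|a_\alpha|^2<\infty$. Such an $f$ is identified with the holomorphic function $f(z)=\sum_{\alpha\in\mathbb{N}^n}a_\alpha z_1^{\alpha_1}\cdots z_n^{\alpha_n}$ on $\mathbb{D}^n$. Capacity: for a positive measurable function $g$ on $\mathbb{T}^n$ let $$Bg(\theta)=\int_{\mathbb{T}^n}\frac{1}{|e^{i\theta_1}-e^{i\psi_1}|^{1/2}}\cdots\frac{1}{|e^{i\theta_n}-e^{i\psi_n}|^{1/2}}\,g(\psi)\,d\psi\in[0,\infty].$$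 For a set $E\subset\mathbb{T}^n$ let $C(E)=\inf\{\|g\|_{L^2(\mathbb{T}^n)}^2 : g\ge 0,\ Bg(\theta)\ge 1 \text{ for all } \theta\in E\}$. *)

theory Defs
  imports "HOL-Analysis.Analysis"
begin

definition polydisc :: "(complex ^ 'n) set" where
  "polydisc = {z. \<forall>i. norm (z $ i) < 1}"

definition torus :: "(complex ^ 'n) set" where
  "torus = {z. \<forall>i. norm (z $ i) = 1}"

definition angle_cube :: "(real ^ 'n) set" where
  "angle_cube = {\<theta>. \<forall>i. 0 \<le> \<theta> $ i \<and> \<theta> $ i < 2 * pi}"

text \<open>Functions on the torus are integrated in angular coordinates, so the normalized Lebesgue
  measure of the torus is realised as a probability measure with underlying space the half-open
  cube \<^term>\<open>angle_cube\<close>.\<close>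

definition torus_measure :: "(real ^ 'n) measure" where
  "torus_measure = scale_measure (ennreal (1 / (2 * pi) ^ CARD('n))) (lebesgue_on angle_cube)"

text \<open>The point at which the potential is evaluated is kept as a point of \<^term>\<open>torus\<close>, while the
  density is a function of the angles. Division is taken in \<^typ>\<open>ennreal\<close>, so the kernel is
  infinite where one of the distances vanishes.\<close>

definition potential :: "(real ^ 'n \<Rightarrow> real) \<Rightarrow> complex ^ 'n \<Rightarrow> ennreal" where
  "potential g \<zeta> =
     (\<integral>\<^sup>+ \<psi>. (\<Prod>i\<in>UNIV. 1 / ennreal (norm (\<zeta> $ i - cis (\<psi> $ i)) powr (1 / 2))) * ennreal (g \<psi>)
        \<partial>torus_measure)"

definition capacity :: "(complex ^ 'n) set \<Rightarrow> ennreal" where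
  "capacity E =
     Inf {(\<integral>\<^sup>+ \<psi>. ennreal ((g \<psi>)\<^sup>2) \<partial>torus_measure) | g.
            g \<in> borel_measurable torus_measure \<and> (\<forall>\<psi>\<in>angle_cube. 0 \<le> g \<psi>) \<and>
            (\<forall>\<zeta>\<in>E. 1 \<le> potential g \<zeta>)}"

text \<open>A function belongs to the Dirichlet space according to its values on \<^term>\<open>polydisc\<close> only;
  its values elsewhere are arbitrary.\<close>

definition dirichlet_space :: "(complex ^ 'n \<Rightarrow> complex) set" where
  "dirichlet_space =
     {f. \<exists>a :: nat ^ 'n \<Rightarrow> complex.
           (\<lambda>\<alpha>. (\<Prod>i\<in>UNIV. real (\<alpha> $ i) + 1) * (norm (a \<alpha>))\<^sup>2) summable_on UNIV \<and>
           (\<forall>z\<in>polydisc. ((\<lambda>\<alpha>. a \<alpha> * (\<Prod>i\<in>UNIV. (z $ i) ^ (\<alpha> $ i))) has_sum f z) UNIV)}"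

end

theory Submission
  imports Defs
begin

text \<open>Every density \<open>G \<ge> 0\<close> in \<open>L\<^sup>2\<close> of the torus admits a Dirichlet function \<open>f\<close> whose real part
  dominates the potential of \<open>G\<close> on the whole polydisc. Capacity zero provides \<open>G = sup k g\<^sub>k\<close> in
  \<open>L\<^sup>2\<close> whose potential is infinite on \<open>E\<close>, and Fatou's lemma makes this potential, hence \<open>Re f\<close>, tend
  to infinity at each point of \<open>E\<close>.

  The dominating \<open>f\<close> comes from convex separation. Let \<open>Q(x) = \<Sum> \<beta>\<^sub>m\<^sup>2 x\<^sup>m\<close>, where \<open>\<beta>\<^sub>m\<close> are the
  Taylor coefficients of \<open>(1 - x) powr (-1/2)\<close>. As \<open>Re Q \<ge> -1\<close> and \<open>Im Q\<close> is bounded, for large \<open>L\<close>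
  the kernel \<open>k(z,w) = \<Prod> (L + Q(z\<^sub>j cnj w\<^sub>j))\<close> satisfies \<open>Re k(z,w) \<ge> 1/2 \<Prod> (1 + Re Q(z\<^sub>j cnj w\<^sub>j))\<close>,
  which in turn dominates half the \<open>L\<^sup>2\<close> inner product of the Riesz kernels with poles \<open>z\<close> and \<open>w\<close>.
  So a combination \<open>\<Sum> c(z) k(\<cdot>,z)\<close> with \<open>c \<ge> 0\<close> has norm at least a multiple of the norm of
  \<open>\<Sum> c(z) b(z)\<close>, \<open>b(z)\<close> the Riesz kernels, and by Cauchy-Schwarz at least a multiple of
  \<open>\<Sum> c(z) BG(z)\<close>. Hence the convex hull of the \<open>k(\<cdot>,z) / BG(z)\<close> stays away from \<open>0\<close>. A multiple of
  its minimal-norm point is \<open>f\<close>; the space with reproducing kernel \<open>k\<close> lies in the Dirichlet space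
  because the coefficients of \<open>L + Q\<close> are \<open>O(1/(m+1))\<close>.\<close>

section \<open>Convex separation in a space of square-summable functions\<close>

text \<open>Values lie in a real inner product space; for complex coefficients
  \<open>l2_inner\<close> is then the real part of the Hermitian product, the quantity that becomes
  \<open>Re f\<close>.\<close>

definition square_summable :: "('i \<Rightarrow> 'b::real_inner) \<Rightarrow> bool" where
  "square_summable u \<longleftrightarrow> (\<lambda>i. (norm (u i))\<^sup>2) summable_on UNIV"

definition l2_inner :: "('i \<Rightarrow> 'b::real_inner) \<Rightarrow> ('i \<Rightarrow> 'b) \<Rightarrow> real" where
  "l2_inner u v = (\<Sum>\<^sub>\<infinity>i. u i \<bullet> v i)"

lemma abs_inner_le_weighted:
  fixes x y :: "'b::real_inner"
  assumes "t > 0"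
  shows "2 * \<bar>x \<bullet> y\<bar> \<le> (norm x)\<^sup>2 / t + t * (norm y)\<^sup>2"
proof -
  have "0 \<le> (norm x - t * norm y)\<^sup>2" by simp
  hence "2 * t * (norm x * norm y) \<le> (norm x)\<^sup>2 + t\<^sup>2 * (norm y)\<^sup>2"
    by (simp add: power2_eq_square algebra_simps)
  hence "2 * t * \<bar>x \<bullet> y\<bar> \<le> (norm x)\<^sup>2 + t\<^sup>2 * (norm y)\<^sup>2"
    using mult_left_mono[OF Cauchy_Schwarz_ineq2[of x y], of "2 * t"] assms by linarith
  thus ?thesis using assms by (simp add: field_simps power2_eq_square)
qed

lemma square_summable_inner_abs_summable:
  assumes "square_summable u" "square_summable v"
  shows "(\<lambda>i. norm (u i \<bullet> v i)) summable_on UNIV"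
proof (rule Infinite_Sum.abs_summable_on_comparison_test')
  show "(\<lambda>i. (norm (u i))\<^sup>2 + (norm (v i))\<^sup>2) summable_on UNIV"
    using assms unfolding square_summable_def by (rule summable_on_add)
  show "norm (u i \<bullet> v i) \<le> (norm (u i))\<^sup>2 + (norm (v i))\<^sup>2" for i
    using abs_inner_le_weighted[of 1 "u i" "v i"] by simp
qed

lemma has_sum_l2_inner:
  assumes "square_summable u" "square_summable v"
  shows "((\<lambda>i. u i \<bullet> v i) has_sum l2_inner u v) UNIV"
  unfolding l2_inner_def
  by (rule has_sum_infsum[OF abs_summable_summable[OF square_summable_inner_abs_summable[OF assms]]])

lemma has_sum_norm_square:
  "square_summable u \<Longrightarrow> ((\<lambda>i. (norm (u i))\<^sup>2) has_sum l2_inner u u) UNIV"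
  using has_sum_l2_inner[of u u] by (simp add: power2_norm_eq_inner)

lemma has_sum_norm_square_lincomb:
  assumes "square_summable u" "square_summable v"
  shows "((\<lambda>i. (norm (a *\<^sub>R u i + b *\<^sub>R v i))\<^sup>2) has_sum
          (a\<^sup>2 * l2_inner u u + 2 * a * b * l2_inner u v + b\<^sup>2 * l2_inner v v)) UNIV"
proof -
  have "((\<lambda>i. a\<^sup>2 * (u i \<bullet> u i) + 2 * a * b * (u i \<bullet> v i) + b\<^sup>2 * (v i \<bullet> v i)) has_sum
          (a\<^sup>2 * l2_inner u u + 2 * a * b * l2_inner u v + b\<^sup>2 * l2_inner v v)) UNIV"
    by (intro has_sum_add has_sum_cmult_right has_sum_l2_inner assms)
  moreover have "(norm (a *\<^sub>R u i + b *\<^sub>R v i))\<^sup>2 =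
      a\<^sup>2 * (u i \<bullet> u i) + 2 * a * b * (u i \<bullet> v i) + b\<^sup>2 * (v i \<bullet> v i)" for i
    unfolding power2_norm_eq_inner
    by (simp add: inner_add_left inner_add_right inner_commute power2_eq_square algebra_simps)
  ultimately show ?thesis by simp
qed

lemma square_summable_lincomb:
  "square_summable u \<Longrightarrow> square_summable v \<Longrightarrow> square_summable (\<lambda>i. a *\<^sub>R u i + b *\<^sub>R v i)"
  using has_sum_norm_square_lincomb[of u v a b] has_sum_imp_summable
  unfolding square_summable_def by blast

lemma l2_inner_lincomb_self:
  assumes "square_summable u" "square_summable v"
  shows "l2_inner (\<lambda>i. a *\<^sub>R u i + b *\<^sub>R v i) (\<lambda>i. a *\<^sub>R u i + b *\<^sub>R v i) =
         a\<^sup>2 * l2_inner u u + 2 * a * b * l2_inner u v + b\<^sup>2 * l2_inner v v"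
  using has_sum_norm_square_lincomb[OF assms]
    has_sum_norm_square[OF square_summable_lincomb[OF assms]] has_sum_unique by blast

lemma l2_inner_self_nonneg: "0 \<le> l2_inner u u"
  unfolding l2_inner_def by (intro infsum_nonneg) simp

lemma norm_square_le_l2_inner:
  assumes "square_summable u"
  shows "(norm (u i))\<^sup>2 \<le> l2_inner u u"
  using has_sum_mono2[OF has_sum_finite[of "{i}"] has_sum_norm_square[OF assms]] by simp

text \<open>Cauchy-Schwarz in the root-free form given by nonnegativity of the squared norm of
  \<open>u - t v\<close>; the free weight \<open>t\<close> is later tied to a step length.\<close>

lemma l2_inner_le_weighted:
  assumes "square_summable u" "square_summable v" "t > 0"
  shows "2 * l2_inner u v \<le> l2_inner u u / t + t * l2_inner v v"
proof -
  have "0 \<le> l2_inner (\<lambda>i. 1 *\<^sub>R u i + (-t) *\<^sub>R v i) (\<lambda>i. 1 *\<^sub>R u i + (-t) *\<^sub>R v i)"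
    by (rule l2_inner_self_nonneg)
  also have "\<dots> = l2_inner u u - 2 * t * l2_inner u v + t\<^sup>2 * l2_inner v v"
    using l2_inner_lincomb_self[OF assms(1,2), of 1 "-t"] by simp
  finally have "t * (2 * l2_inner u v) \<le> t * (l2_inner u u / t + t * l2_inner v v)"
    using assms by (simp add: power2_eq_square algebra_simps)
  thus ?thesis using assms(3) by (simp only: mult_le_cancel_left_pos)
qed

text \<open>Completeness of l2 in quantitative form: coordinates converge, and the bound on finite
  partial sums survives letting \<open>l\<close> tend to infinity.\<close>

lemma square_summable_limit:
  fixes v :: "nat \<Rightarrow> 'i \<Rightarrow> 'b::{real_inner,complete_space}"
  assumes v: "\<And>m. square_summable (v m)"
    and cauchy: "\<And>m l. l2_inner (\<lambda>i. v m i - v l i) (\<lambda>i. v m i - v l i) \<le> e m + e l"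
    and e: "e \<longlonglongrightarrow> 0"
  obtains x where "square_summable x"
    "\<And>m. square_summable (\<lambda>i. v m i - x i)"
    "\<And>m. l2_inner (\<lambda>i. v m i - x i) (\<lambda>i. v m i - x i) \<le> e m"
proof -
  have diff: "square_summable (\<lambda>i. v m i - v l i)" for m l
    using square_summable_lincomb[OF v[of m] v[of l], of 1 "-1"] by simp
  have "Cauchy (\<lambda>m. v m i)" for i
  proof (rule metric_CauchyI)
    fix r :: real assume r: "r > 0"
    hence "\<forall>\<^sub>F m in sequentially. e m < r\<^sup>2 / 2"
      using e by (intro order_tendstoD) auto
    then obtain N where N: "\<And>m. m \<ge> N \<Longrightarrow> e m < r\<^sup>2 / 2"
      unfolding eventually_sequentially by blast
    have "dist (v m i) (v l i) < r" if "m \<ge> N" "l \<ge> N" for m l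
    proof -
      have "(dist (v m i) (v l i))\<^sup>2 \<le> e m + e l"
        unfolding dist_norm
        using norm_square_le_l2_inner[OF diff[of m l]] cauchy[of m l] by (rule order_trans)
      also have "\<dots> < r\<^sup>2" using N[of m] N[of l] that by simp
      finally show ?thesis using r by (simp add: power2_less_imp_less)
    qed
    thus "\<exists>N. \<forall>m\<ge>N. \<forall>l\<ge>N. dist (v m i) (v l i) < r" by blast
  qed
  then obtain x where x: "\<And>i. (\<lambda>m. v m i) \<longlonglongrightarrow> x i"
    unfolding Cauchy_convergent_iff convergent_def by metis
  have fin: "(\<Sum>i\<in>F. (norm (v m i - x i))\<^sup>2) \<le> e m" if "finite F" for F m
  proof (rule LIMSEQ_le)
    show "(\<lambda>l. \<Sum>i\<in>F. (norm (v m i - v l i))\<^sup>2) \<longlonglongrightarrow> (\<Sum>i\<in>F. (norm (v m i - x i))\<^sup>2)"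
      by (intro tendsto_intros x)
    show "(\<lambda>l. e m + e l) \<longlonglongrightarrow> e m"
      using tendsto_add[OF tendsto_const e, of "e m"] by simp
    have "(\<Sum>i\<in>F. (norm (v m i - v l i))\<^sup>2) \<le> e m + e l" for l
      using has_sum_mono2[OF has_sum_finite[OF that] has_sum_norm_square[OF diff[of m l]]]
        cauchy[of m l] by simp
    thus "\<exists>N. \<forall>l\<ge>N. (\<Sum>i\<in>F. (norm (v m i - v l i))\<^sup>2) \<le> e m + e l" by blast
  qed
  have sq: "square_summable (\<lambda>i. v m i - x i)" for m
    unfolding square_summable_def
    by (rule nonneg_bdd_above_summable_on) (auto intro!: bdd_aboveI2[of _ _ "e m"] fin)
  have bound: "l2_inner (\<lambda>i. v m i - x i) (\<lambda>i. v m i - x i) \<le> e m" for m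
    using has_sum_le_finite_sums[OF has_sum_norm_square[OF sq[of m]]] fin by blast
  have "square_summable x"
    using square_summable_lincomb[OF v[of 0] sq[of 0], of 1 "-1"] by simp
  with sq bound show thesis using that by blast
qed

lemma l2_inner_diff_left:
  assumes "square_summable u" "square_summable v" "square_summable w"
  shows "l2_inner (\<lambda>i. u i - v i) w = l2_inner u w - l2_inner v w"
proof -
  have "((\<lambda>i. u i \<bullet> w i + - (v i \<bullet> w i)) has_sum (l2_inner u w + - l2_inner v w)) UNIV"
    by (intro has_sum_add has_sum_uminusI has_sum_l2_inner assms)
  thus ?thesis
    unfolding l2_inner_def[of "\<lambda>i. u i - v i"] by (intro infsumI) (simp add: inner_diff_left)
qed

text \<open>The separating vector is a multiple of the point of minimal norm in the closure of \<open>V\<close>.\<close>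

lemma convex_l2_separation:
  fixes V :: "('i \<Rightarrow> 'b::{real_inner,complete_space}) set"
  assumes sq: "\<And>v. v \<in> V \<Longrightarrow> square_summable v"
    and convex: "\<And>u v t. u \<in> V \<Longrightarrow> v \<in> V \<Longrightarrow> 0 \<le> t \<Longrightarrow> t \<le> 1 \<Longrightarrow>
                   (\<lambda>i. (1 - t) *\<^sub>R u i + t *\<^sub>R v i) \<in> V"
    and lower: "\<And>v. v \<in> V \<Longrightarrow> \<delta> \<le> l2_inner v v" and "\<delta> > 0"
  shows "\<exists>x. square_summable x \<and> (\<forall>v\<in>V. 1 \<le> l2_inner x v)"
proof (cases "V = {}")
  \<comment> \<open>The infimum below needs a nonempty \<open>V\<close>; in the application
    \<open>V\<close> is empty when the potential vanishes on the whole polydisc.\<close>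
  case True
  thus ?thesis by (intro exI[of _ "\<lambda>_. 0"]) (simp add: square_summable_def)
next
  case False
  define d where "d = (INF v\<in>V. l2_inner v v)"
  have bdd: "bdd_below ((\<lambda>v. l2_inner v v) ` V)"
    using lower by (intro bdd_belowI2)
  have d_le: "d \<le> l2_inner v v" if "v \<in> V" for v
    unfolding d_def using bdd that by (rule cINF_lower)
  have "\<delta> \<le> d" unfolding d_def using False lower by (intro cINF_greatest)
  hence "d > 0" using \<open>\<delta> > 0\<close> by linarith
  \<comment> \<open>A positive null sequence; squared norms below \<open>d + e m / 2\<close> make
    the parallelogram law give exactly \<open>e m + e l\<close>.\<close>
  define e where "e = (\<lambda>m::nat. 2 / (real m + 1))"
  have e_pos: "e m > 0" for m by (simp add: e_def)
  have e_lim: "e \<longlonglongrightarrow> 0"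
    unfolding e_def using tendsto_mult[OF tendsto_const LIMSEQ_inverse_real_of_nat, of 2]
    by (simp add: field_simps)
  have "\<exists>v\<in>V. l2_inner v v < d + e m / 2" for m
    using cINF_less_iff[OF False bdd, of "d + e m / 2"] e_pos[of m] unfolding d_def by simp
  then obtain v where v: "\<And>m. v m \<in> V" and v_less: "\<And>m. l2_inner (v m) (v m) < d + e m / 2"
    by metis
  have "l2_inner (\<lambda>i. v m i - v l i) (\<lambda>i. v m i - v l i) \<le> e m + e l" for m l
  proof -
    \<comment> \<open>Parallelogram law: the midpoint of \<open>v m\<close> and \<open>v l\<close>
      lies in \<open>V\<close>, so its squared norm is at least \<open>d\<close>, which forces the
      two points to be close.\<close>
    have "d \<le> l2_inner (\<lambda>i. (1 - 1/2) *\<^sub>R v m i + (1/2) *\<^sub>R v l i) (\<lambda>i. (1 - 1/2) *\<^sub>R v m i + (1/2) *\<^sub>R v l i)"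
      by (intro d_le convex v) auto
    also have "\<dots> = l2_inner (v m) (v m) / 4 + l2_inner (v m) (v l) / 2 + l2_inner (v l) (v l) / 4"
      using l2_inner_lincomb_self[OF sq[OF v] sq[OF v], where a="1-1/2" and b="1/2"]
      by (simp add: power2_eq_square)
    finally show ?thesis
      using l2_inner_lincomb_self[OF sq[OF v] sq[OF v], where a=1 and b="-1", of m l]
        v_less[of m] v_less[of l] by simp
  qed
  then obtain x where x: "square_summable x" and vx: "\<And>m. square_summable (\<lambda>i. v m i - x i)"
    and vx_le: "\<And>m. l2_inner (\<lambda>i. v m i - x i) (\<lambda>i. v m i - x i) \<le> e m"
    using square_summable_limit[of v e, OF sq[OF v] _ e_lim] by blast
  have inner_ge: "d \<le> l2_inner x u" if u: "u \<in> V" for u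
  proof -
    \<comment> \<open>Variational inequality at the minimum: a step \<open>t\<close> from
      \<open>v m\<close> towards \<open>u\<close> stays in \<open>V\<close>. First \<open>m\<close>
      tends to infinity with \<open>t\<close> fixed, which removes \<open>e m / t\<close>; then one
      factor \<open>t\<close> is divided out.\<close>
    have key: "(2 - t) * d \<le> 2 * (1 - t) * l2_inner x u + 2 * t * l2_inner u u"
      if t: "0 < t" "t < 1" for t
    proof -
      have "d \<le> (1 - t)\<^sup>2 * (d + e m / 2)
              + t * (1 - t) * (2 * l2_inner x u + e m / t + t * l2_inner u u) + t\<^sup>2 * l2_inner u u"
        for m
      proof -
        have "2 * l2_inner (\<lambda>i. v m i - x i) u \<le> e m / t + t * l2_inner u u"
          using l2_inner_le_weighted[OF vx[of m] sq[OF u] t(1)]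
            divide_right_mono[OF vx_le[of m], of t] t by simp
        hence i: "2 * l2_inner (v m) u \<le> 2 * l2_inner x u + e m / t + t * l2_inner u u"
          using l2_inner_diff_left[OF sq[OF v] x sq[OF u]] by simp
        have "d \<le> l2_inner (\<lambda>i. (1 - t) *\<^sub>R v m i + t *\<^sub>R u i) (\<lambda>i. (1 - t) *\<^sub>R v m i + t *\<^sub>R u i)"
          using t by (intro d_le convex v u) auto
        also have "\<dots> = (1 - t)\<^sup>2 * l2_inner (v m) (v m) + t * (1 - t) * (2 * l2_inner (v m) u)
            + t\<^sup>2 * l2_inner u u"
          using l2_inner_lincomb_self[OF sq[OF v] sq[OF u], where a="1-t" and b=t] by simp
        also have "\<dots> \<le> (1 - t)\<^sup>2 * (d + e m / 2)
            + t * (1 - t) * (2 * l2_inner x u + e m / t + t * l2_inner u u) + t\<^sup>2 * l2_inner u u"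
          using t v_less[of m] i by (intro add_mono mult_left_mono) auto
        finally show ?thesis .
      qed
      moreover have "(\<lambda>m. (1 - t)\<^sup>2 * (d + e m / 2)
          + t * (1 - t) * (2 * l2_inner x u + e m / t + t * l2_inner u u) + t\<^sup>2 * l2_inner u u)
          \<longlonglongrightarrow> (1 - t)\<^sup>2 * (d + 0 / 2)
          + t * (1 - t) * (2 * l2_inner x u + 0 / t + t * l2_inner u u) + t\<^sup>2 * l2_inner u u"
        using t by (intro tendsto_intros e_lim) auto
      ultimately have "d \<le> (1 - t)\<^sup>2 * d
          + t * (1 - t) * (2 * l2_inner x u + t * l2_inner u u) + t\<^sup>2 * l2_inner u u"
        by (intro LIMSEQ_le_const[where a=d]) auto
      hence "t * ((2 - t) * d) \<le> t * (2 * (1 - t) * l2_inner x u + (2 - t) * t * l2_inner u u)"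
        by (simp add: power2_eq_square algebra_simps)
      hence "(2 - t) * d \<le> 2 * (1 - t) * l2_inner x u + (2 - t) * t * l2_inner u u"
        using t by (simp only: mult_le_cancel_left_pos)
      moreover have "(2 - t) * t * l2_inner u u \<le> 2 * t * l2_inner u u"
        using t l2_inner_self_nonneg[of u] by (intro mult_right_mono) auto
      ultimately show ?thesis by linarith
    qed
    \<comment> \<open>Letting \<open>t\<close> decrease to \<open>0\<close> leaves
      \<open>2 * d \<le> 2 * l2_inner x u\<close>.\<close>
    have "((\<lambda>t. 2 * (1 - t) * l2_inner x u + 2 * t * l2_inner u u - (2 - t) * d)
        \<longlongrightarrow> 2 * (1 - 0) * l2_inner x u + 2 * 0 * l2_inner u u - (2 - 0) * d) (at_right 0)"
      by (intro tendsto_intros)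
    moreover have "\<forall>\<^sub>F t in at_right 0. 0 \<le> 2 * (1 - t) * l2_inner x u + 2 * t * l2_inner u u - (2 - t) * d"
      using key unfolding eventually_at_right_field by (intro exI[of _ 1]) auto
    ultimately have "0 \<le> 2 * (1 - 0) * l2_inner x u + 2 * 0 * l2_inner u u - (2 - 0) * d"
      by (rule tendsto_lowerbound) simp
    thus ?thesis by simp
  qed
  show ?thesis
  proof (intro exI[of _ "\<lambda>i. (1 / d) *\<^sub>R x i"] conjI ballI)
    show "square_summable (\<lambda>i. (1 / d) *\<^sub>R x i)"
      using square_summable_lincomb[OF x x, of "1/d" 0] by simp
    fix u assume u: "u \<in> V"
    have "l2_inner (\<lambda>i. (1 / d) *\<^sub>R x i) u = l2_inner x u / d"
      using has_sum_cmult_right[OF has_sum_l2_inner[OF x sq[OF u]], of "1/d"]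
      unfolding l2_inner_def[of "\<lambda>i. (1 / d) *\<^sub>R x i"] by (intro infsumI) (simp)
    thus "1 \<le> l2_inner (\<lambda>i. (1 / d) *\<^sub>R x i) u"
      using inner_ge[OF u] \<open>d > 0\<close> by simp
  qed
qed

section \<open>The one-dimensional kernel\<close>

text \<open>These are the central binomial coefficients divided by \<open>4 ^ m\<close>, the \<beta>
  coefficients of the overview.\<close>

definition sqrt_coeff :: "nat \<Rightarrow> real" where
  "sqrt_coeff m = pochhammer (1/2) m / fact m"

lemma sqrt_coeff_0 [simp]: "sqrt_coeff 0 = 1"
  by (simp add: sqrt_coeff_def)

lemma sqrt_coeff_Suc: "sqrt_coeff (Suc m) = sqrt_coeff m * ((2 * real m + 1) / (2 * real m + 2))"
proof -
  have "(1/2 + real m) / (real m + 1) = (2 * real m + 1) / (2 * real m + 2)"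
    by (simp add: field_simps)
  thus ?thesis by (simp add: sqrt_coeff_def pochhammer_Suc field_simps)
qed

lemma sqrt_coeff_pos: "sqrt_coeff m > 0"
  by (simp add: sqrt_coeff_def pochhammer_pos)

text \<open>By the ratio recurrence the induction step reduces to
  \<open>(2m + 1) (2m + 3) \<le> (2m + 2)^2\<close>. This decay of order 1/m is what puts the kernel
  space inside the Dirichlet space.\<close>

lemma sqrt_coeff_square_le: "(sqrt_coeff m)\<^sup>2 \<le> 1 / (2 * real m + 1)"
proof (induction m)
  case (Suc m)
  have "(sqrt_coeff (Suc m))\<^sup>2 = (sqrt_coeff m)\<^sup>2 * ((2 * real m + 1) / (2 * real m + 2))\<^sup>2"
    unfolding sqrt_coeff_Suc power_mult_distrib ..
  also have "\<dots> \<le> 1 / (2 * real m + 1) * ((2 * real m + 1) / (2 * real m + 2))\<^sup>2"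
    by (intro mult_right_mono Suc) simp
  also have "\<dots> = (2 * real m + 1) / (2 * real m + 2)\<^sup>2"
    by (simp add: power2_eq_square)
  also have "\<dots> \<le> 1 / (2 * real (Suc m) + 1)"
    by (simp add: divide_simps) (simp add: power2_eq_square algebra_simps)
  finally show ?case .
qed simp

lemma sqrt_coeff_le_1: "sqrt_coeff m \<le> 1"
proof -
  have "(sqrt_coeff m)\<^sup>2 \<le> 1"
    using sqrt_coeff_square_le[of m] by (rule order_trans) simp
  thus ?thesis by (rule power2_le_imp_le[where y=1, simplified])
qed

lemma inverse_sqrt_sums:
  fixes x :: complex
  assumes "norm x < 1"
  shows "(\<lambda>m. of_real (sqrt_coeff m) * x ^ m) sums ((1 - x) powr (-1/2))"
proof -
  have "(\<lambda>m. ((-1/2) gchoose m) * (-x) ^ m) sums ((1 + -x) powr (-1/2))"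
    by (rule gen_binomial_complex) (use assms in simp)
  moreover have "((-1/2) gchoose m) * (-x) ^ m = of_real (sqrt_coeff m) * x ^ m" for m
  proof -
    have "complex_of_real (pochhammer (1/2) m) = pochhammer (1/2) m"
      using pochhammer_of_real[of "1/2" m, where 'a=complex] by simp
    moreover have "((-1) ^ m * a / b) * ((-1) ^ m * c) = a / b * c" for a b c :: complex
      using power_mult_distrib[of "-1" "-1::complex" m] by (simp add: field_simps)
    ultimately show ?thesis
      unfolding gbinomial_pochhammer power_minus[of x m] by (simp add: sqrt_coeff_def)
  qed
  ultimately show ?thesis by simp
qed

text \<open>\<open>1 - x\<close> lies in the right half-plane, so its inverse square root has
  argument below \<open>pi / 4\<close> in modulus, where the cosine is at least
  \<open>sqrt 2 / 2\<close>.\<close>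

lemma norm_powr_le_Re_inverse_sqrt:
  fixes x :: complex
  assumes "norm x < 1"
  shows "norm (1 - x) powr (-1/2) \<le> sqrt 2 * Re ((1 - x) powr (-1/2))"
proof -
  define y where "y = 1 - x"
  have "Re y > 0" using assms complex_Re_le_cmod[of x] by (simp add: y_def)
  hence "y \<noteq> 0" by auto
  have "\<bar>Im (Ln y)\<bar> < pi / 2" using \<open>Re y > 0\<close> by (rule Re_Ln_pos_lt_imp)
  hence "cos (pi / 4) \<le> cos \<bar>Im (Ln y) / 2\<bar>"
    by (intro cos_monotone_0_pi_le) auto
  hence c: "sqrt 2 / 2 \<le> cos (Im (Ln y) / 2)" unfolding cos_abs_real by (simp add: cos_45)
  have "Re (y powr (-1/2)) = norm y powr (-1/2) * cos (Im (Ln y) / 2)"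
    using \<open>y \<noteq> 0\<close> by (simp add: powr_def Re_exp cos_minus flip: minus_divide_left)
  moreover have "norm y powr (-1/2) * (sqrt 2 / 2) \<le> norm y powr (-1/2) * cos (Im (Ln y) / 2)"
    using c by (intro mult_left_mono) auto
  ultimately have "sqrt 2 * (norm y powr (-1/2) * (sqrt 2 / 2)) \<le> sqrt 2 * Re (y powr (-1/2))"
    by simp
  moreover have "sqrt 2 * (a * (sqrt 2 / 2)) = a" for a by (simp add: field_simps)
  ultimately show ?thesis by (simp only: y_def)
qed

lemma Re_inverse_sqrt_nonneg:
  fixes x :: complex
  assumes "norm x < 1"
  shows "0 \<le> Re ((1 - x) powr (-1/2))"
proof -
  have "0 \<le> norm (1 - x) powr (-1/2)" by simp
  also note norm_powr_le_Re_inverse_sqrt[OF assms]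
  finally show ?thesis by (simp add: zero_le_mult_iff)
qed

text \<open>The function \<open>Q\<close> of the overview; classically \<open>2 / pi\<close> times
  the complete elliptic integral of the first kind, with \<open>x\<close> the squared
  modulus.\<close>

definition elliptic_series :: "complex \<Rightarrow> complex" where
  "elliptic_series x = (\<Sum>m. of_real ((sqrt_coeff m)\<^sup>2) * x ^ m)"

lemma summable_norm_elliptic_series:
  fixes x :: complex
  assumes "norm x < 1"
  shows "summable (\<lambda>m. norm (of_real ((sqrt_coeff m)\<^sup>2) * x ^ m))"
proof (rule summable_comparison_test')
  show "summable (\<lambda>m. norm x ^ m)" using assms by (simp add: summable_geometric)
  fix m
  have "(sqrt_coeff m)\<^sup>2 \<le> 1"
    using sqrt_coeff_square_le[of m] by (rule order_trans) simp
  thus "norm (norm (complex_of_real ((sqrt_coeff m)\<^sup>2) * x ^ m)) \<le> norm x ^ m"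
    by (simp add: norm_mult norm_power mult_left_le_one_le)
qed

lemma summable_norm_sqrt_coeff:
  fixes x :: complex
  assumes "norm x < 1"
  shows "summable (\<lambda>m. norm (of_real (sqrt_coeff m) * x ^ m))"
proof (rule summable_comparison_test')
  show "summable (\<lambda>m. norm x ^ m)" using assms by (simp add: summable_geometric)
  show "norm (norm (complex_of_real (sqrt_coeff m) * x ^ m)) \<le> norm x ^ m" for m
    using sqrt_coeff_pos[of m] sqrt_coeff_le_1[of m]
    by (simp add: norm_mult norm_power mult_left_le_one_le)
qed

section \<open>Fourier integrals of the boundary kernels\<close>

text \<open>Termwise integration: the uniform bound on the \<open>e m\<close> and absolute
  summability of \<open>a\<close> give uniform convergence by the Weierstrass test.\<close>

lemma has_integral_function_series:
  fixes a c :: "nat \<Rightarrow> complex" and e :: "nat \<Rightarrow> real \<Rightarrow> complex"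
  assumes a: "summable (\<lambda>m. norm (a m))"
    and e: "\<And>m. continuous_on {p..q} (e m)" "\<And>m t. t \<in> {p..q} \<Longrightarrow> norm (e m t) \<le> B"
    and c: "\<And>m. (e m has_integral c m) {p..q}"
    and g: "\<And>t. t \<in> {p..q} \<Longrightarrow> (\<lambda>m. a m * e m t) sums g t"
    and s: "(\<lambda>m. a m * c m) sums s"
  shows "(g has_integral s) {p..q}"
proof -
  define f where "f = (\<lambda>n t. \<Sum>m<n. a m * e m t)"
  have "uniform_limit {p..q} f (\<lambda>t. \<Sum>m. a m * e m t) sequentially"
    unfolding f_def
  proof (rule Weierstrass_m_test)
    show "norm (a n * e n t) \<le> norm (a n) * B" if "t \<in> {p..q}" for n t
      using e(2)[OF that] by (simp add: norm_mult mult_left_mono)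
    show "summable (\<lambda>n. norm (a n) * B)" using a by (rule summable_mult2)
  qed
  moreover have "continuous_on {p..q} (f n)" for n
    unfolding f_def by (intro continuous_intros e)
  ultimately obtain I J where I: "\<And>n. (f n has_integral I n) {p..q}"
    and J: "((\<lambda>t. \<Sum>m. a m * e m t) has_integral J) {p..q}" and IJ: "I \<longlonglongrightarrow> J"
    by (rule uniform_limit_integral) auto
  have "(f n has_integral (\<Sum>m<n. a m * c m)) {p..q}" for n
    unfolding f_def by (intro has_integral_sum has_integral_mult_right c) auto
  hence "I = (\<lambda>n. \<Sum>m<n. a m * c m)"
    using I has_integral_unique by blast
  hence "J = s" using IJ s LIMSEQ_unique unfolding sums_def by blast
  with J have "((\<lambda>t. \<Sum>m. a m * e m t) has_integral s) {p..q}" by simp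
  thus ?thesis
    by (rule has_integral_eq[rotated]) (use g in \<open>simp add: sums_iff\<close>)
qed

lemma has_integral_cis_int:
  "((\<lambda>t. cis (of_int k * t)) has_integral (if k = 0 then of_real (2 * pi) else 0)) {0..2 * pi}"
proof (cases "k = 0")
  case True
  thus ?thesis using has_integral_const_real[of "1::complex" 0 "2 * pi"] by (simp add: scaleR_conv_of_real)
next
  case False
  have d: "((\<lambda>t. cis (of_int k * t) / (\<i> * of_int k)) has_vector_derivative cis (of_int k * t))
      (at t within {0..2 * pi})" for t
  proof -
    have "((\<lambda>z. exp (\<i> * of_int k * z) / (\<i> * of_int k)) has_field_derivative
        exp (\<i> * of_int k * of_real t)) (at (of_real t))"
      using False by (auto intro!: derivative_eq_intros)
    from has_vector_derivative_real_field[OF this] show ?thesis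
      by (simp add: cis_conv_exp mult.assoc)
  qed
  have "((\<lambda>t. cis (of_int k * t)) has_integral
      (cis (of_int k * (2 * pi)) / (\<i> * of_int k) - cis (of_int k * 0) / (\<i> * of_int k))) {0..2 * pi}"
    by (rule fundamental_theorem_of_calculus) (use d in auto)
  moreover have "cis (of_int k * (2 * pi)) = 1"
    using cis_multiple_2pi[of "of_int k"] by (simp add: mult_ac)
  ultimately show ?thesis using False by simp
qed

lemma cis_minus_power: "cis (- t) ^ m = cis (- (real m * t))"
  using Complex.DeMoivre[of "- t" m] by simp

text \<open>In the expansion in powers of \<open>z * cis (-t)\<close>, orthogonality keeps only the
  term \<open>m = k\<close>, so negative \<open>k\<close> gives zero.\<close>

lemma has_integral_inverse_sqrt_cis:
  assumes "norm z < 1"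
  shows "((\<lambda>t. (1 - z * cis (-t)) powr (-1/2) * cis (of_int k * t)) has_integral
          (if k \<ge> 0 then of_real (2 * pi * sqrt_coeff (nat k)) * z ^ nat k else 0)) {0..2 * pi}"
proof (rule has_integral_function_series[where B=1])
  show "summable (\<lambda>m. norm (complex_of_real (sqrt_coeff m) * z ^ m))"
    using assms by (rule summable_norm_sqrt_coeff)
  define e where "e = (\<lambda>m t. cis (of_int (k - int m) * t))"
  define c where "c = (\<lambda>m::nat. if k - int m = 0 then complex_of_real (2 * pi) else 0)"
  show "continuous_on {0..2 * pi} (e m)" for m unfolding e_def by (intro continuous_intros)
  show "norm (e m t) \<le> 1" for m t by (simp add: e_def)
  show "(e m has_integral c m) {0..2 * pi}" for m
    unfolding e_def c_def by (rule has_integral_cis_int)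
  show "(\<lambda>m. of_real (sqrt_coeff m) * z ^ m * e m t) sums
      ((1 - z * cis (-t)) powr (-1/2) * cis (of_int k * t))" for t
  proof -
    have "(\<lambda>m. of_real (sqrt_coeff m) * (z * cis (-t)) ^ m * cis (of_int k * t)) sums
      ((1 - z * cis (-t)) powr (-1/2) * cis (of_int k * t))"
      by (intro sums_mult2 inverse_sqrt_sums) (use assms in \<open>simp add: norm_mult\<close>)
    moreover have "(z * cis (-t)) ^ m * cis (of_int k * t) = z ^ m * e m t" for m
      unfolding e_def power_mult_distrib cis_minus_power by (simp add: cis_mult algebra_simps)
    ultimately show ?thesis by (simp add: mult.assoc)
  qed
  show "(\<lambda>m. of_real (sqrt_coeff m) * z ^ m * c m) sums
      (if k \<ge> 0 then of_real (2 * pi * sqrt_coeff (nat k)) * z ^ nat k else 0)"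
  proof (cases "k \<ge> 0")
    case True
    have "(\<lambda>m. of_real (sqrt_coeff m) * z ^ m * c m) sums (of_real (sqrt_coeff (nat k)) * z ^ nat k * c (nat k))"
      using True by (intro sums_finite[of "{nat k}", simplified]) (auto simp: c_def)
    thus ?thesis using True by (simp add: c_def mult_ac)
  next
    case False
    hence "c m = 0" for m by (simp add: c_def)
    thus ?thesis using False by simp
  qed
qed

lemma Re_one_minus_pos:
  assumes "norm z < 1"
  shows "Re (1 - z * cis t) > 0"
  using assms complex_Re_le_cmod[of "z * cis t"] by (simp add: norm_mult del: times_complex.sel)

lemma continuous_on_inverse_sqrt_cis:
  assumes "norm z < 1"
  shows "continuous_on A (\<lambda>t. (1 - z * cis (-t)) powr (-1/2))"
proof -
  define y where "y = (\<lambda>t. 1 - z * cis (-t))"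
  have "Re (y t) > 0" for t
    using Re_one_minus_pos[OF assms, of "-t"] by (simp only: y_def)
  hence "Re (y t) \<ge> 0" "y t \<noteq> 0" for t
    by (simp_all add: less_imp_le) (metis less_irrefl zero_complex.sel(1))
  moreover have "continuous_on A y" unfolding y_def by (intro continuous_intros)
  ultimately have "continuous_on A (\<lambda>t. y t powr (-1/2))"
    by (intro continuous_intros) auto
  thus ?thesis by (simp only: y_def)
qed

lemma norm_inverse_sqrt_cis_le:
  assumes "norm z < 1"
  shows "norm ((1 - z * cis (-t)) powr (-1/2)) \<le> (1 - norm z) powr (-1/2)"
proof -
  have "1 - norm z \<le> norm (1 - z * cis (-t))"
    using norm_triangle_ineq2[of 1 "z * cis (-t)"] by (simp add: norm_mult)
  moreover have "norm ((1 - z * cis (-t)) powr (-1/2)) = norm (1 - z * cis (-t)) powr (-1/2)"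
    by (subst norm_powr_real_powr') (auto)
  ultimately show ?thesis using assms by (simp add: powr_mono2')
qed

text \<open>The second factor is expanded and integrated against the Fourier coefficients of the
  first. Without conjugation all frequencies have one sign and only the constant term survives; with
  conjugation the diagonal terms build \<open>elliptic_series\<close>.\<close>

lemma has_integral_inverse_sqrt_mult:
  assumes "norm z < 1" "norm w < 1"
  shows "((\<lambda>t. (1 - z * cis (-t)) powr (-1/2) * (1 - w * cis (-t)) powr (-1/2))
           has_integral of_real (2 * pi)) {0..2 * pi}"
    and "((\<lambda>t. (1 - z * cis (-t)) powr (-1/2) * cnj ((1 - w * cis (-t)) powr (-1/2)))
           has_integral of_real (2 * pi) * elliptic_series (z * cnj w)) {0..2 * pi}"
proof -
  define s where "s = (\<lambda>t. (1 - z * cis (-t)) powr (-1/2))"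
  have bound: "norm (s t * cis r) \<le> (1 - norm z) powr (-1/2)" for t r
    using norm_inverse_sqrt_cis_le[OF assms(1)] by (simp add: s_def norm_mult)
  have cont: "continuous_on {0..2 * pi} (\<lambda>t. s t * cis (of_int k * t))" for k
    unfolding s_def by (intro continuous_intros continuous_on_inverse_sqrt_cis assms)
  have int: "((\<lambda>t. s t * cis (of_int k * t)) has_integral
          (if k \<ge> 0 then of_real (2 * pi * sqrt_coeff (nat k)) * z ^ nat k else 0)) {0..2 * pi}" for k
    unfolding s_def by (rule has_integral_inverse_sqrt_cis[OF assms(1)])
  have "((\<lambda>t. s t * (1 - w * cis (-t)) powr (-1/2)) has_integral of_real (2 * pi)) {0..2 * pi}"
  proof (rule has_integral_function_series[OF summable_norm_sqrt_coeff[OF assms(2)] cont bound int])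
    show "(\<lambda>m. of_real (sqrt_coeff m) * w ^ m * (s t * cis (of_int (- int m) * t))) sums
        (s t * (1 - w * cis (-t)) powr (-1/2))" for t
    proof -
      have "(\<lambda>m. s t * (of_real (sqrt_coeff m) * (w * cis (-t)) ^ m)) sums
        (s t * (1 - w * cis (-t)) powr (-1/2))"
        by (intro sums_mult inverse_sqrt_sums) (use assms in \<open>simp add: norm_mult\<close>)
      thus ?thesis unfolding power_mult_distrib cis_minus_power by (simp add: mult_ac)
    qed
    have "(\<lambda>m. of_real (sqrt_coeff m) * w ^ m * (if - int m \<ge> 0 then of_real (2 * pi * sqrt_coeff (nat (- int m))) * z ^ nat (- int m) else 0))
       sums (of_real (sqrt_coeff 0) * w ^ 0 * (if - int 0 \<ge> 0 then of_real (2 * pi * sqrt_coeff (nat (- int 0))) * z ^ nat (- int 0) else 0))"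
      by (intro sums_finite[of "{0}", simplified]) auto
    thus "(\<lambda>m. of_real (sqrt_coeff m) * w ^ m * (if - int m \<ge> 0 then of_real (2 * pi * sqrt_coeff (nat (- int m))) * z ^ nat (- int m) else 0))
       sums of_real (2 * pi)" by simp
  qed
  thus "((\<lambda>t. (1 - z * cis (-t)) powr (-1/2) * (1 - w * cis (-t)) powr (-1/2))
           has_integral of_real (2 * pi)) {0..2 * pi}" by (simp add: s_def)
  have nw: "norm (cnj w) < 1" using assms by simp
  have "((\<lambda>t. s t * cnj ((1 - w * cis (-t)) powr (-1/2))) has_integral
      of_real (2 * pi) * elliptic_series (z * cnj w)) {0..2 * pi}"
  proof (rule has_integral_function_series[OF summable_norm_sqrt_coeff[OF nw] cont bound int])
    show "(\<lambda>m. of_real (sqrt_coeff m) * cnj w ^ m * (s t * cis (of_int (int m) * t))) sums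
        (s t * cnj ((1 - w * cis (-t)) powr (-1/2)))" for t
    proof -
      have "(\<lambda>m. s t * cnj (of_real (sqrt_coeff m) * (w * cis (-t)) ^ m)) sums
        (s t * cnj ((1 - w * cis (-t)) powr (-1/2)))"
        by (intro sums_mult inverse_sqrt_sums sums_cnj[THEN iffD2]) (use assms in \<open>simp add: norm_mult\<close>)
      thus ?thesis
        unfolding power_mult_distrib cis_minus_power
        by (simp add: mult_ac cis_cnj)
    qed
    have nzw: "norm (z * cnj w) < 1"
      using mult_strict_mono'[OF assms norm_ge_zero norm_ge_zero] by (simp add: norm_mult)
    have "(\<lambda>m. of_real (2 * pi) * (of_real ((sqrt_coeff m)\<^sup>2) * (z * cnj w) ^ m)) sums
       (of_real (2 * pi) * elliptic_series (z * cnj w))"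
      unfolding elliptic_series_def
      by (intro sums_mult summable_sums summable_norm_cancel[OF summable_norm_elliptic_series[OF nzw]])
    thus "(\<lambda>m. of_real (sqrt_coeff m) * cnj w ^ m * (if int m \<ge> 0 then of_real (2 * pi * sqrt_coeff (nat (int m))) * z ^ nat (int m) else 0))
       sums (of_real (2 * pi) * elliptic_series (z * cnj w))"
      by (simp add: power_mult_distrib mult_ac power2_eq_square)
  qed
  thus "((\<lambda>t. (1 - z * cis (-t)) powr (-1/2) * cnj ((1 - w * cis (-t)) powr (-1/2)))
           has_integral of_real (2 * pi) * elliptic_series (z * cnj w)) {0..2 * pi}"
    by (simp add: s_def)
qed

text \<open>Sum of the two preceding integrals, by
  \<open>2 * Re a * Re b = Re (a * b + a * cnj b)\<close>.\<close>

lemma has_integral_Re_inverse_sqrt_mult: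
  assumes "norm z < 1" "norm w < 1"
  shows "((\<lambda>t. 2 * Re ((1 - z * cis (-t)) powr (-1/2)) * Re ((1 - w * cis (-t)) powr (-1/2)))
     has_integral 2 * pi * (1 + Re (elliptic_series (z * cnj w)))) {0..2 * pi}"
proof -
  have "((\<lambda>t. Re ((1 - z * cis (-t)) powr (-1/2) * (1 - w * cis (-t)) powr (-1/2) +
        (1 - z * cis (-t)) powr (-1/2) * cnj ((1 - w * cis (-t)) powr (-1/2))))
     has_integral Re (of_real (2 * pi) + of_real (2 * pi) * elliptic_series (z * cnj w))) {0..2 * pi}"
    by (intro has_integral_Re has_integral_add has_integral_inverse_sqrt_mult assms)
  moreover have "Re (a * b + a * cnj b) = 2 * Re a * Re b" for a b by simp
  ultimately show ?thesis by (simp only: plus_complex.sel times_complex.sel Re_complex_of_real Im_complex_of_real) (simp add: algebra_simps)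
qed

text \<open>As \<open>norm (v - cis t) = norm (1 - v * cis (-t))\<close>, each Riesz factor is at
  most \<open>sqrt 2\<close> times the real part of an inverse square root; the two constants
  multiply to the \<open>2\<close> of the preceding integral.\<close>

lemma nn_integral_kernel_product_le:
  assumes "norm z < 1" "norm w < 1"
  shows "(\<integral>\<^sup>+ t. indicator {0..<2 * pi} t *
      (1 / ennreal (norm (z - cis t) powr (1/2)) * (1 / ennreal (norm (w - cis t) powr (1/2)))) \<partial>lborel)
    \<le> ennreal (2 * pi * (1 + Re (elliptic_series (z * cnj w))))"
proof -
  define r where "r = (\<lambda>t. 2 * Re ((1 - z * cis (-t)) powr (-1/2)) * Re ((1 - w * cis (-t)) powr (-1/2)))"
  have one: "0 < norm (v - cis t) \<and> norm (v - cis t) powr (-1/2) \<le> sqrt 2 * Re ((1 - v * cis (-t)) powr (-1/2))"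
    if "norm v < 1" for v t
  proof -
    have "norm (v - cis t) = norm ((1 - v * cis (-t)) * (- cis t))"
      by (simp add: algebra_simps cis_mult)
    hence "norm (v - cis t) = norm (1 - v * cis (-t))" by (simp add: norm_mult)
    moreover have "norm (1 - v * cis (-t)) > 0"
      using Re_one_minus_pos[OF that, of "-t"] complex_Re_le_cmod order_less_le_trans by blast
    ultimately show ?thesis
      using norm_powr_le_Re_inverse_sqrt[of "v * cis (-t)"] that by (simp add: norm_mult)
  qed
  have e: "1 / ennreal (norm (v - cis t) powr (1/2)) = ennreal (norm (v - cis t) powr (-1/2))"
    if "norm v < 1" for v t
    using one[OF that, of t] divide_ennreal[of 1 "norm (v - cis t) powr (1/2)"] by (simp add: powr_minus_divide)
  have nn: "0 \<le> Re ((1 - v * cis (-t)) powr (-1 / 2))" if "norm v < 1" for v t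
    by (rule Re_inverse_sqrt_nonneg) (use that in \<open>simp add: norm_mult\<close>)
  have "1 / ennreal (norm (z - cis t) powr (1/2)) * (1 / ennreal (norm (w - cis t) powr (1/2))) \<le> ennreal (r t)" for t
  proof -
    have "norm (z - cis t) powr (-1/2) * norm (w - cis t) powr (-1/2) \<le>
      (sqrt 2 * Re ((1 - z * cis (-t)) powr (-1/2))) * (sqrt 2 * Re ((1 - w * cis (-t)) powr (-1/2)))"
      using one[OF assms(1), of t] one[OF assms(2), of t] nn[OF assms(1), of t]
      by (intro mult_mono) auto
    also have "\<dots> = r t" by (simp add: r_def)
    finally show ?thesis using assms by (simp add: e ennreal_leI flip: ennreal_mult)
  qed
  hence "(\<integral>\<^sup>+ t. indicator {0..<2 * pi} t *
      (1 / ennreal (norm (z - cis t) powr (1/2)) * (1 / ennreal (norm (w - cis t) powr (1/2)))) \<partial>lborel)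
    \<le> (\<integral>\<^sup>+ t. ennreal (r t) * indicator {0..2 * pi} t \<partial>lborel)"
    by (intro nn_integral_mono) (auto split: split_indicator)
  also have "\<dots> = ennreal (2 * pi * (1 + Re (elliptic_series (z * cnj w))))"
    using has_integral_Re_inverse_sqrt_mult[OF assms] nn assms
    unfolding r_def by (intro nn_integral_has_integral_lebesgue') auto
  finally show ?thesis .
qed

text \<open>The integral of a product of two nonnegative real parts is a positive multiple of
  \<open>1 + Re (elliptic_series (z * cnj w))\<close>.\<close>

lemma Re_elliptic_series_ge:
  assumes "norm z < 1" "norm w < 1"
  shows "-1 \<le> Re (elliptic_series (z * cnj w))"
proof -
  have nn: "0 \<le> Re ((1 - v * cis (-t)) powr (-1 / 2))" if "norm v < 1" for v t
    by (rule Re_inverse_sqrt_nonneg) (use that in \<open>simp add: norm_mult\<close>)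
  have "0 \<le> 2 * pi * (1 + Re (elliptic_series (z * cnj w)))"
    by (rule has_integral_nonneg[OF has_integral_Re_inverse_sqrt_mult[OF assms]]) (use nn assms in simp)
  hence "0 \<le> 1 + Re (elliptic_series (z * cnj w))"
    using pi_gt_zero by (simp add: zero_le_mult_iff)
  thus ?thesis by simp
qed

text \<open>\<open>m * (sqrt_coeff m)\<^sup>2\<close> converges with error \<open>O(1/m)\<close>, so the series differs from a multiple of
  \<open>Ln (1 - x)\<close>, whose imaginary part is bounded, by a bounded function.\<close>

lemma Im_elliptic_series_bounded:
  obtains M where "\<And>x. norm x < 1 \<Longrightarrow> \<bar>Im (elliptic_series x)\<bar> \<le> M"
proof -
  \<comment> \<open>The index is shifted: \<open>d m\<close> is the index times the squared
    coefficient, taken at \<open>m + 1\<close>. It increases and is bounded by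
    \<open>1 / 2\<close>.\<close>
  define d where "d = (\<lambda>m. real (Suc m) * (sqrt_coeff (Suc m))\<^sup>2)"
  have d_Suc: "d (Suc m) = d m + d m / (4 * (real m + 1) * (real m + 2))" for m
    unfolding d_def sqrt_coeff_Suc[of "Suc m"] power_mult_distrib
    by (simp add: divide_simps) (simp add: power2_eq_square algebra_simps)
  have d_le: "0 \<le> d m \<and> d m \<le> 1 / 2" for m
  proof -
    have "d m \<le> real (Suc m) * (1 / (2 * real (Suc m) + 1))"
      unfolding d_def by (intro mult_left_mono sqrt_coeff_square_le) simp
    also have "\<dots> \<le> 1 / 2" by (simp add: field_simps)
    finally show ?thesis by (simp add: d_def)
  qed
  have "incseq d"
    using d_le by (intro incseq_SucI) (simp add: d_Suc)
  then obtain D where D: "d \<longlonglongrightarrow> D" and d_le_D: "\<And>m. d m \<le> D"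
    using d_le incseq_convergent[of d "1/2"] by blast
  \<comment> \<open>With \<open>d \<le> 1 / 2\<close> each increment is at most
    \<open>1 / (8 (m + 1) (m + 2))\<close>, which telescopes.\<close>
  have gap: "d l \<le> d m + (1 / (8 * (real m + 1)) - 1 / (8 * (real l + 1)))" if "m \<le> l" for m l
    using that
  proof (induction l rule: dec_induct)
    case (step l)
    have "d l / (4 * (real l + 1) * (real l + 2)) \<le> (1/2) / (4 * (real l + 1) * (real l + 2))"
      using d_le[of l] by (intro divide_right_mono) auto
    also have "\<dots> = 1 / (8 * (real l + 1)) - 1 / (8 * (real (Suc l) + 1))"
      by (simp add: divide_simps) (simp add: algebra_simps)
    finally show ?case using step.IH unfolding d_Suc by linarith
  qed simp
  have "d l \<le> d m + 1 / (real m + 1)" if "m \<le> l" for m l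
  proof -
    have "1 / (8 * (real m + 1)) \<le> 1 / (real m + 1)" by (simp add: divide_simps)
    moreover have "0 \<le> 1 / (8 * (real l + 1))" by simp
    ultimately show ?thesis using gap[OF that] by linarith
  qed
  hence D_le: "D \<le> d m + 1 / (real m + 1)" for m
    using LIMSEQ_le_const2[OF D] by blast
  define S where "S = (\<Sum>m. 1 / (real m + 1)\<^sup>2)"
  have S: "summable (\<lambda>m. 1 / (real m + 1)\<^sup>2)"
    using inverse_squares_sums by (simp add: sums_iff add.commute)
  have "D \<ge> 0" using d_le d_le_D order_trans by blast
  have "\<bar>Im (elliptic_series x)\<bar> \<le> D * (pi / 2) + S" if x: "norm x < 1" for x
  proof -
    define g where "g = (\<lambda>m. of_real ((d m - D) / (real m + 1)) * x ^ Suc m)"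
    have "(\<lambda>m. of_real ((sqrt_coeff m)\<^sup>2) * x ^ m) sums elliptic_series x"
      unfolding elliptic_series_def
      by (intro summable_sums summable_norm_cancel[OF summable_norm_elliptic_series[OF x]])
    hence 1: "(\<lambda>m. of_real ((sqrt_coeff (Suc m))\<^sup>2) * x ^ Suc m) sums (elliptic_series x - 1)"
      by (subst sums_Suc_iff) simp
    have "(\<lambda>m. - ((- (-x)) ^ m) / of_nat m) sums ln (1 + (-x))"
      by (rule Ln_series') (use x in simp)
    hence 2: "(\<lambda>m. - (x ^ Suc m) / of_nat (Suc m)) sums ln (1 - x)"
      by (subst sums_Suc_iff) simp
    \<comment> \<open>Adding \<open>D * ln (1 - x)\<close> cancels the leading part
      \<open>D / (m + 1)\<close> of the coefficients; the remainder is of order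
      \<open>1 / (m + 1)^2\<close>, hence summable uniformly in the disc.\<close>
    have "(\<lambda>m. of_real ((sqrt_coeff (Suc m))\<^sup>2) * x ^ Suc m + of_real D * (- (x ^ Suc m) / of_nat (Suc m)))
        sums (elliptic_series x - 1 + of_real D * ln (1 - x))"
      by (intro sums_add sums_mult 1 2)
    moreover have "of_real ((sqrt_coeff (Suc m))\<^sup>2) * x ^ Suc m + of_real D * (- (x ^ Suc m) / of_nat (Suc m)) = g m" for m
    proof -
      have "(sqrt_coeff (Suc m))\<^sup>2 = d m / real (Suc m)" by (simp add: d_def)
      moreover have "of_real ((d m - D) / (real m + 1)) = (of_real (d m) - of_real D) / (of_nat (Suc m) :: complex)"
        by (simp add: add.commute)
      moreover have "a / c * y + b * (- y / c) = (a - b) / c * y" for a b c y :: complex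
        by (simp add: diff_divide_distrib algebra_simps)
      ultimately show ?thesis by (simp only: g_def of_real_divide of_real_of_nat_eq)
    qed
    ultimately have g: "g sums (elliptic_series x - 1 + of_real D * ln (1 - x))" by simp
    have g_le: "norm (g m) \<le> 1 / (real m + 1)\<^sup>2" for m
    proof -
      have "norm (g m) = \<bar>d m - D\<bar> / (real m + 1) * norm x ^ Suc m"
        unfolding g_def norm_mult norm_of_real norm_power by simp
      also have "\<dots> \<le> (1 / (real m + 1)) / (real m + 1) * 1"
        using d_le_D[of m] D_le[of m] x
        by (intro mult_mono divide_right_mono power_le_one) auto
      finally show ?thesis by (simp add: power2_eq_square)
    qed
    have "norm (elliptic_series x - 1 + of_real D * ln (1 - x)) \<le> S"
      using norm_suminf_le[OF g_le S] g unfolding S_def by (simp add: sums_iff)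
    hence "\<bar>Im (elliptic_series x) + D * Im (ln (1 - x))\<bar> \<le> S"
      using abs_Im_le_cmod[of "elliptic_series x - 1 + of_real D * ln (1 - x)"] by simp
    moreover have "\<bar>D * Im (ln (1 - x))\<bar> \<le> D * (pi / 2)"
    proof -
      have "Re (1 - x) > 0" using x complex_Re_le_cmod[of x] by simp
      hence "\<bar>Im (ln (1 - x))\<bar> \<le> pi / 2" by (intro less_imp_le Re_Ln_pos_lt_imp)
      from mult_left_mono[OF this \<open>D \<ge> 0\<close>] show ?thesis using \<open>D \<ge> 0\<close> by (simp add: abs_mult)
    qed
    ultimately show ?thesis by linarith
  qed
  thus thesis by (rule that)
qed

section \<open>The reproducing kernel on the polydisc\<close>

text \<open>Both products are expanded without their constant term and compared monomial by
  monomial; the induction does this one factor at a time.\<close>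

lemma norm_prod_one_plus_minus_one_le:
  fixes f :: "'i \<Rightarrow> complex"
  assumes "finite I"
  shows "norm ((\<Prod>i\<in>I. 1 + f i) - 1) \<le> (\<Prod>i\<in>I. 1 + norm (f i)) - 1"
  using assms
proof (induction I)
  case (insert j I)
  have "(\<Prod>i\<in>insert j I. 1 + f i) - 1 = ((\<Prod>i\<in>I. 1 + f i) - 1) + f j * (\<Prod>i\<in>I. 1 + f i)"
    using insert.hyps by (simp add: algebra_simps)
  also have "norm \<dots> \<le> norm ((\<Prod>i\<in>I. 1 + f i) - 1) + norm (f j) * norm (\<Prod>i\<in>I. 1 + f i)"
    by (rule order_trans[OF norm_triangle_ineq]) (simp add: norm_mult)
  also have "\<dots> \<le> ((\<Prod>i\<in>I. 1 + norm (f i)) - 1) + norm (f j) * (\<Prod>i\<in>I. 1 + norm (f i))"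
  proof (intro add_mono insert.IH mult_left_mono)
    show "norm (\<Prod>i\<in>I. 1 + f i) \<le> (\<Prod>i\<in>I. 1 + norm (f i))"
      unfolding prod_norm[symmetric] by (intro prod_mono conjI norm_ge_zero norm_triangle_le) simp
  qed simp
  also have "\<dots> = (\<Prod>i\<in>insert j I. 1 + norm (f i)) - 1"
    using insert.hyps by (simp add: algebra_simps)
  finally show ?case .
qed simp

text \<open>Taking out the real parts leaves factors \<open>1 + f i\<close> with
  \<open>norm (f i) \<le> \<epsilon>\<close>, whose product is within \<open>1 / 2\<close> of
  \<open>1\<close>.\<close>

lemma Re_prod_ge_half_prod_Re:
  fixes u :: "'n::finite \<Rightarrow> complex"
  assumes pos: "\<And>i. Re (u i) > 0" and im: "\<And>i. \<bar>Im (u i)\<bar> \<le> \<epsilon> * Re (u i)"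
    and \<epsilon>: "(1 + \<epsilon>) ^ CARD('n) \<le> 3 / 2"
  shows "(\<Prod>i\<in>UNIV. Re (u i)) / 2 \<le> Re (\<Prod>i\<in>UNIV. u i)"
proof -
  define f where "f = (\<lambda>i. \<i> * of_real (Im (u i) / Re (u i)))"
  have u: "u i = of_real (Re (u i)) * (1 + f i)" for i
    using pos[of i] by (simp add: f_def complex_eq_iff)
  have norm_f: "norm (f i) \<le> \<epsilon>" for i
  proof -
    have "norm (f i) = \<bar>Im (u i)\<bar> / Re (u i)"
      using pos[of i] unfolding f_def norm_mult norm_of_real by simp
    thus ?thesis using im[of i] pos[of i] by (simp add: divide_le_eq)
  qed
  have "norm ((\<Prod>i\<in>UNIV. 1 + f i) - 1) \<le> (\<Prod>i\<in>UNIV. 1 + norm (f i)) - 1"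
    by (rule norm_prod_one_plus_minus_one_le) simp
  also have "(\<Prod>i\<in>UNIV. 1 + norm (f i)) \<le> (\<Prod>i\<in>(UNIV::'n set). 1 + \<epsilon>)"
    by (intro prod_mono) (simp add: norm_f)
  finally have "norm ((\<Prod>i\<in>UNIV. 1 + f i) - 1) \<le> 1 / 2" using \<epsilon> by simp
  hence "1 / 2 \<le> Re (\<Prod>i\<in>UNIV. 1 + f i)"
    using abs_Re_le_cmod[of "(\<Prod>i\<in>UNIV. 1 + f i) - 1"] by simp
  moreover have "Re (\<Prod>i\<in>UNIV. u i) = (\<Prod>i\<in>UNIV. Re (u i)) * Re (\<Prod>i\<in>UNIV. 1 + f i)"
  proof -
    have "(\<Prod>i\<in>UNIV. u i) = (\<Prod>i\<in>UNIV. of_real (Re (u i)) * (1 + f i))"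
      by (rule prod.cong[OF refl u])
    also have "\<dots> = of_real (\<Prod>i\<in>UNIV. Re (u i)) * (\<Prod>i\<in>UNIV. 1 + f i)"
      by (simp add: prod.distrib)
    finally show ?thesis
      by (simp only: scaleR_conv_of_real[symmetric] scaleR_complex.sel)
  qed
  moreover have "(\<Prod>i\<in>UNIV. Re (u i)) \<ge> 0" using pos by (simp add: prod_nonneg less_imp_le)
  ultimately show ?thesis
    using mult_left_mono[of "1/2" "Re (\<Prod>i\<in>UNIV. 1 + f i)" "\<Prod>i\<in>UNIV. Re (u i)"] by simp
qed

section \<open>Power series and coefficient vectors of the kernel\<close>

definition kernel_coeff :: "real \<Rightarrow> nat \<Rightarrow> real" where
  "kernel_coeff L m = (if m = 0 then L else 0) + (sqrt_coeff m)\<^sup>2"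

lemma kernel_coeff_pos: "L \<ge> 0 \<Longrightarrow> kernel_coeff L m > 0"
  using sqrt_coeff_pos[of m] by (simp add: kernel_coeff_def add_nonneg_pos)

lemma kernel_coeff_le:
  assumes "L \<ge> 0"
  shows "(real m + 1) * kernel_coeff L m \<le> L + 1"
proof (cases "m = 0")
  case False
  have "(real m + 1) * (sqrt_coeff m)\<^sup>2 \<le> (real m + 1) * (1 / (2 * real m + 1))"
    by (intro mult_left_mono sqrt_coeff_square_le) simp
  also have "\<dots> \<le> 1" by (simp add: field_simps)
  finally show ?thesis using False assms by (simp add: kernel_coeff_def)
qed (simp add: kernel_coeff_def)

lemma kernel_coeff_sums:
  fixes x :: complex
  assumes "norm x < 1"
  shows "(\<lambda>m. of_real (kernel_coeff L m) * x ^ m) sums (of_real L + elliptic_series x)"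
proof -
  have "(\<lambda>m. if m = 0 then of_real L * x ^ m else 0) sums (of_real L * x ^ 0)"
    by (rule sums_single)
  moreover have "(\<lambda>m. of_real ((sqrt_coeff m)\<^sup>2) * x ^ m) sums elliptic_series x"
    unfolding elliptic_series_def
    by (intro summable_sums summable_norm_cancel[OF summable_norm_elliptic_series[OF assms]])
  ultimately have "(\<lambda>m. (if m = 0 then of_real L * x ^ m else 0) + of_real ((sqrt_coeff m)\<^sup>2) * x ^ m)
      sums (of_real L * x ^ 0 + elliptic_series x)"
    by (rule sums_add)
  moreover have "(if m = 0 then of_real L * x ^ m else 0) + of_real ((sqrt_coeff m)\<^sup>2) * x ^ m
      = of_real (kernel_coeff L m) * x ^ m" for m
    by (simp add: kernel_coeff_def)
  ultimately show ?thesis by simp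
qed

lemma kernel_coeff_summable_norm:
  fixes x :: complex
  assumes "norm x < 1" "L \<ge> 0"
  shows "(\<lambda>m. norm (of_real (kernel_coeff L m) * x ^ m)) summable_on UNIV"
proof -
  have "summable (\<lambda>m. norm (of_real (kernel_coeff L m) * x ^ m))"
  proof (rule summable_comparison_test')
    show "summable (\<lambda>m. (L + 1) * norm x ^ m)"
      using assms by (intro summable_mult summable_geometric) simp
    fix m
    have "1 * kernel_coeff L m \<le> (real m + 1) * kernel_coeff L m"
      using kernel_coeff_pos[OF assms(2), of m] by (intro mult_right_mono) auto
    hence "kernel_coeff L m \<le> L + 1" using kernel_coeff_le[OF assms(2), of m] by linarith
    thus "norm (norm (complex_of_real (kernel_coeff L m) * x ^ m)) \<le> (L + 1) * norm x ^ m"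
      using kernel_coeff_pos[OF assms(2), of m] by (simp add: norm_mult norm_power mult_right_mono)
  qed
  thus ?thesis by (simp add: summable_on_UNIV_nonneg_real_iff)
qed

definition kernel_weight :: "real \<Rightarrow> nat ^ 'n \<Rightarrow> real" where
  "kernel_weight L \<alpha> = (\<Prod>i\<in>UNIV. kernel_coeff L (\<alpha> $ i))"

lemma kernel_weight_pos: "L \<ge> 0 \<Longrightarrow> kernel_weight L \<alpha> > 0"
  unfolding kernel_weight_def by (intro prod_pos ballI kernel_coeff_pos)

lemma bij_betw_vec_nth: "bij_betw vec_nth (UNIV :: ('a ^ 'n) set) UNIV"
  by (rule bij_betwI[where g=vec_lambda]) auto

text \<open>A finite product of absolutely convergent series is the sum over all multi-indices;
  vectors are identified with functions through the bijection \<open>vec_nth\<close>.\<close>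

lemma kernel_weight_has_sum:
  fixes x :: "'n::finite \<Rightarrow> complex"
  assumes x: "\<And>i. norm (x i) < 1" and L: "L \<ge> 0"
  shows "((\<lambda>\<alpha>. of_real (kernel_weight L \<alpha>) * (\<Prod>i\<in>UNIV. x i ^ (\<alpha> $ i))) has_sum
         (\<Prod>i\<in>UNIV. of_real L + elliptic_series (x i))) UNIV"
proof -
  define f where "f = (\<lambda>i m. of_real (kernel_coeff L m) * x i ^ m)"
  define g where "g = (\<lambda>\<alpha>. \<Prod>i\<in>UNIV. f i (\<alpha> i))"
  have f: "(\<lambda>m. norm (f i m)) summable_on UNIV" for i
    unfolding f_def using x L by (rule kernel_coeff_summable_norm)
  have "Infinite_Set_Sum.abs_summable_on g (PiE UNIV (\<lambda>_. UNIV))"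
    unfolding g_def by (intro abs_summable_on_prod_PiE f[unfolded abs_summable_equivalent]) auto
  hence g: "(\<lambda>\<alpha>. norm (g \<alpha>)) summable_on UNIV"
    by (simp add: abs_summable_equivalent)
  have "infsum g (PiE UNIV (\<lambda>_. UNIV)) = (\<Prod>i\<in>UNIV. infsum (f i) UNIV)"
    unfolding g_def by (intro infsum_prod_PiE_abs f) auto
  moreover have "infsum (f i) UNIV = of_real L + elliptic_series (x i)" for i
  proof -
    have "f i sums infsum (f i) UNIV"
      by (intro has_sum_imp_sums has_sum_infsum abs_summable_summable[OF f])
    thus ?thesis using kernel_coeff_sums[OF x, of L i] sums_unique2 unfolding f_def by blast
  qed
  ultimately have "(g has_sum (\<Prod>i\<in>UNIV. of_real L + elliptic_series (x i))) UNIV"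
    using has_sum_infsum[OF abs_summable_summable[OF g]] by simp
  hence "((\<lambda>\<alpha>. g (vec_nth \<alpha>)) has_sum (\<Prod>i\<in>UNIV. of_real L + elliptic_series (x i))) UNIV"
    by (subst has_sum_reindex_bij_betw[OF bij_betw_vec_nth])
  moreover have "g (vec_nth \<alpha>) = of_real (kernel_weight L \<alpha>) * (\<Prod>i\<in>UNIV. x i ^ (\<alpha> $ i))" for \<alpha>
    by (simp add: g_def f_def kernel_weight_def prod.distrib)
  ultimately show "((\<lambda>\<alpha>. of_real (kernel_weight L \<alpha>) * (\<Prod>i\<in>UNIV. x i ^ (\<alpha> $ i))) has_sum
         (\<Prod>i\<in>UNIV. of_real L + elliptic_series (x i))) UNIV" by simp
qed

text \<open>Coordinates whose inner products return the kernel: the square root splits the weight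
  evenly, and the conjugate makes \<open>x \<alpha> * cnj (kernel_vector L z \<alpha>)\<close> a
  monomial in \<open>z\<close>.\<close>

definition kernel_vector :: "real \<Rightarrow> complex ^ 'n \<Rightarrow> nat ^ 'n \<Rightarrow> complex" where
  "kernel_vector L z \<alpha> = of_real (sqrt (kernel_weight L \<alpha>)) * (\<Prod>i\<in>UNIV. cnj (z $ i) ^ (\<alpha> $ i))"

lemma norm_mult_cnj_less_1:
  fixes z w :: complex
  assumes "norm z < 1" "norm w < 1"
  shows "norm (z * cnj w) < 1"
  using mult_strict_mono'[OF assms norm_ge_zero norm_ge_zero] by (simp add: norm_mult)

lemma inner_kernel_vector:
  assumes "L \<ge> 0"
  shows "kernel_vector L z \<alpha> \<bullet> kernel_vector L w \<alpha> =
    Re (of_real (kernel_weight L \<alpha>) * (\<Prod>i\<in>UNIV. (w $ i * cnj (z $ i)) ^ (\<alpha> $ i)))"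
proof -
  have "a \<bullet> b = Re (a * cnj b)" for a b :: complex by (simp add: inner_complex_def)
  moreover have "complex_of_real (sqrt (kernel_weight L \<alpha>)) * of_real (sqrt (kernel_weight L \<alpha>)) =
      of_real (kernel_weight L \<alpha>)"
    using kernel_weight_pos[OF assms, of \<alpha>] by (simp flip: of_real_mult)
  moreover have "kernel_vector L z \<alpha> * cnj (kernel_vector L w \<alpha>) =
      (complex_of_real (sqrt (kernel_weight L \<alpha>)) * of_real (sqrt (kernel_weight L \<alpha>))) *
      (\<Prod>i\<in>UNIV. (w $ i * cnj (z $ i)) ^ (\<alpha> $ i))"
    by (simp add: kernel_vector_def power_mult_distrib prod.distrib)
  ultimately show ?thesis by (simp only:)
qed

lemma kernel_vector_square_summable:
  assumes "z \<in> polydisc" "L \<ge> 0"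
  shows "square_summable (kernel_vector L z)"
proof -
  have "((\<lambda>\<alpha>. Re (of_real (kernel_weight L \<alpha>) * (\<Prod>i\<in>UNIV. (z $ i * cnj (z $ i)) ^ (\<alpha> $ i)))) has_sum
      Re (\<Prod>i\<in>UNIV. of_real L + elliptic_series (z $ i * cnj (z $ i)))) UNIV"
    using assms by (intro has_sum_Re kernel_weight_has_sum norm_mult_cnj_less_1) (auto simp: polydisc_def)
  thus ?thesis
    unfolding square_summable_def
    by (simp only: power2_norm_eq_inner inner_kernel_vector[OF assms(2)] has_sum_imp_summable)
qed

lemma l2_inner_kernel_vector:
  assumes "z \<in> polydisc" "w \<in> polydisc" "L \<ge> 0"
  shows "l2_inner (kernel_vector L z) (kernel_vector L w) =
    Re (\<Prod>i\<in>UNIV. of_real L + elliptic_series (w $ i * cnj (z $ i)))"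
  unfolding l2_inner_def inner_kernel_vector[OF assms(3)]
  using assms by (intro infsumI has_sum_Re kernel_weight_has_sum norm_mult_cnj_less_1) (auto simp: polydisc_def)

lemma has_sum_finite_sum:
  fixes f :: "'j \<Rightarrow> 'i \<Rightarrow> 'b::topological_comm_monoid_add"
  assumes "finite S" "\<And>j. j \<in> S \<Longrightarrow> (f j has_sum s j) A"
  shows "((\<lambda>i. \<Sum>j\<in>S. f j i) has_sum (\<Sum>j\<in>S. s j)) A"
  using assms by (induction S) (auto intro!: has_sum_add)

text \<open>Gram expansion, stated as a convergent sum so that it yields square-summability and the
  norm together.\<close>

lemma has_sum_l2_inner_finite_sum:
  assumes "finite S" "\<And>z. z \<in> S \<Longrightarrow> square_summable (v z)"
  shows "((\<lambda>i. (norm (\<Sum>z\<in>S. c z *\<^sub>R v z i))\<^sup>2) has_sum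
      (\<Sum>z\<in>S. \<Sum>w\<in>S. c z * c w * l2_inner (v z) (v w))) UNIV"
proof -
  have "((\<lambda>i. \<Sum>z\<in>S. \<Sum>w\<in>S. c z * c w * (v z i \<bullet> v w i)) has_sum
      (\<Sum>z\<in>S. \<Sum>w\<in>S. c z * c w * l2_inner (v z) (v w))) UNIV"
    by (intro has_sum_finite_sum has_sum_cmult_right has_sum_l2_inner assms)
  moreover have "(norm (\<Sum>z\<in>S. c z *\<^sub>R v z i))\<^sup>2 = (\<Sum>z\<in>S. \<Sum>w\<in>S. c z * c w * (v z i \<bullet> v w i))" for i
    unfolding power2_norm_eq_inner inner_sum_left inner_sum_right
    by (intro sum.cong refl) (simp add: inner_commute mult.assoc)
  ultimately show ?thesis by simp
qed

text \<open>Adding a large constant to the kernel keeps the argument of each factor small enough for the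
  product of the real parts to control the real part of the product.\<close>

lemma kernel_constant_exists:
  obtains L where "L \<ge> 0"
    "\<And>z w :: complex ^ 'n. z \<in> polydisc \<Longrightarrow> w \<in> polydisc \<Longrightarrow>
       (\<Prod>i\<in>UNIV. 1 + Re (elliptic_series (w $ i * cnj (z $ i)))) / 2
         \<le> l2_inner (kernel_vector L z) (kernel_vector L w)"
proof -
  obtain M where M: "\<And>x. norm x < 1 \<Longrightarrow> \<bar>Im (elliptic_series x)\<bar> \<le> M"
    using Im_elliptic_series_bounded by blast
  have "M \<ge> 0" using M[of 0] by simp
  \<comment> \<open>Continuity at \<open>0\<close> supplies the \<epsilon> demanded by
    \<open>Re_prod_ge_half_prod_Re\<close>.\<close>
  have "((\<lambda>\<epsilon>. (1 + \<epsilon>) ^ CARD('n)) \<longlongrightarrow> (1 + 0 :: real) ^ CARD('n)) (at_right 0)"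
    by (intro tendsto_intros)
  hence "\<forall>\<^sub>F \<epsilon> in at_right 0. (1 + \<epsilon> :: real) ^ CARD('n) < 3 / 2"
    by (rule order_tendstoD) simp
  then obtain \<epsilon> :: real where \<epsilon>: "\<epsilon> > 0" "(1 + \<epsilon>) ^ CARD('n) \<le> 3 / 2"
    unfolding eventually_at_right_field by (metis dense less_imp_le)
  \<comment> \<open>As \<open>Re Q \<ge> -1\<close>, this makes the real parts at least
    \<open>M / \<epsilon> + 1\<close>, so that \<epsilon> times a real part exceeds the bound
    \<open>M\<close> on the imaginary parts.\<close>
  define L where "L = M / \<epsilon> + 2"
  have "L \<ge> 2" using \<open>M \<ge> 0\<close> \<epsilon> by (simp add: L_def)
  have "(\<Prod>i\<in>UNIV. 1 + Re (elliptic_series (w $ i * cnj (z $ i)))) / 2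
         \<le> l2_inner (kernel_vector L z) (kernel_vector L w)"
    if zw: "z \<in> polydisc" "w \<in> polydisc" for z w :: "complex ^ 'n"
  proof -
    define u where "u = (\<lambda>i. of_real L + elliptic_series (w $ i * cnj (z $ i)))"
    have n: "norm (z $ i) < 1" "norm (w $ i) < 1" for i using zw by (auto simp: polydisc_def)
    have ge: "-1 \<le> Re (elliptic_series (w $ i * cnj (z $ i)))" for i
      by (intro Re_elliptic_series_ge n)
    have Re_u: "M / \<epsilon> + 1 \<le> Re (u i)" for i using ge[of i] by (simp add: u_def L_def)
    have "0 \<le> M / \<epsilon>" using \<open>M \<ge> 0\<close> \<epsilon> by simp
    have "(\<Prod>i\<in>UNIV. 1 + Re (elliptic_series (w $ i * cnj (z $ i)))) \<le> (\<Prod>i\<in>UNIV. Re (u i))"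
    proof (intro prod_mono conjI)
      show "0 \<le> 1 + Re (elliptic_series (w $ i * cnj (z $ i)))" for i using ge[of i] by linarith
      show "1 + Re (elliptic_series (w $ i * cnj (z $ i))) \<le> Re (u i)" for i
        using \<open>L \<ge> 2\<close> by (simp add: u_def)
    qed
    also have "(\<Prod>i\<in>UNIV. Re (u i)) / 2 \<le> Re (\<Prod>i\<in>UNIV. u i)"
    proof (rule Re_prod_ge_half_prod_Re[OF _ _ \<epsilon>(2)])
      show "0 < Re (u i)" for i using Re_u[of i] \<open>0 \<le> M / \<epsilon>\<close> by linarith
      show "\<bar>Im (u i)\<bar> \<le> \<epsilon> * Re (u i)" for i
      proof -
        have "\<bar>Im (u i)\<bar> \<le> M" using M[OF norm_mult_cnj_less_1[OF n(2)[of i] n(1)[of i]]] by (simp add: u_def)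
        also have "\<dots> \<le> \<epsilon> * (M / \<epsilon> + 1)" using \<epsilon> by (simp add: distrib_left)
        also have "\<dots> \<le> \<epsilon> * Re (u i)" using Re_u[of i] \<epsilon> by (intro mult_left_mono) auto
        finally show ?thesis .
      qed
    qed
    finally show ?thesis
      using l2_inner_kernel_vector[OF zw, of L] \<open>L \<ge> 2\<close> by (simp add: u_def)
  qed
  with \<open>L \<ge> 2\<close> show thesis by (intro that[of L]) auto
qed

section \<open>Potentials on the torus\<close>

text \<open>Tonelli: the product formula over \<open>Basis\<close> is reindexed by coordinates
  through the unit vectors \<open>axis i 1\<close>.\<close>

lemma nn_integral_lborel_vec_prod:
  fixes h :: "'n::finite \<Rightarrow> real \<Rightarrow> ennreal"
  assumes [measurable]: "\<And>i. h i \<in> borel_measurable borel"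
  shows "(\<integral>\<^sup>+ \<psi>. (\<Prod>i\<in>UNIV. h i ((\<psi> :: real ^ 'n) $ i)) \<partial>lborel) = (\<Prod>i\<in>UNIV. \<integral>\<^sup>+ t. h i t \<partial>lborel)"
proof -
  define b :: "'n \<Rightarrow> real ^ 'n" where "b = (\<lambda>i. axis i 1)"
  have inj: "inj b" by (auto simp: b_def inj_def axis_eq_axis)
  have Basis: "(Basis :: (real ^ 'n) set) = range b" by (auto simp: Basis_vec_def b_def)
  have "(\<integral>\<^sup>+ \<psi>. (\<Prod>i\<in>UNIV. h i ((\<psi> :: real ^ 'n) $ i)) \<partial>lborel) =
      (\<integral>\<^sup>+ \<psi>. (\<Prod>e\<in>Basis. h (inv b e) ((\<psi> :: real ^ 'n) \<bullet> e)) \<partial>lborel)"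
    unfolding Basis prod.reindex[OF inj] by (simp only: o_def inv_f_f[OF inj]) (simp add: b_def inner_axis)
  also have "\<dots> = (\<Prod>e\<in>(Basis :: (real ^ 'n) set). \<integral>\<^sup>+ t. h (inv b e) t \<partial>lborel)"
    by (intro nn_integral_lborel_prod) auto
  also have "\<dots> = (\<Prod>i\<in>UNIV. \<integral>\<^sup>+ t. h i t \<partial>lborel)"
    unfolding Basis prod.reindex[OF inj] by (simp add: inv_f_f[OF inj])
  finally show ?thesis .
qed

lemma borel_measurable_vec_component [measurable]:
  "(\<lambda>\<psi>. (\<psi> :: real ^ 'n) $ i) \<in> borel_measurable borel"
  by (intro borel_measurable_continuous_onI continuous_intros)

lemma angle_cube_borel [measurable]: "(angle_cube :: (real ^ 'n) set) \<in> sets borel"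
proof -
  have "angle_cube = (\<Inter>i. {\<psi> :: real ^ 'n. 0 \<le> \<psi> $ i \<and> \<psi> $ i < 2 * pi})"
    by (auto simp: angle_cube_def)
  also have "\<dots> \<in> sets borel" by measurable
  finally show ?thesis .
qed

lemma angle_cube_lebesgue: "angle_cube \<inter> space lebesgue \<in> sets lebesgue"
  using angle_cube_borel sets_completionI_sets by auto

lemma borel_measurable_torus_measure:
  assumes "f \<in> borel_measurable borel"
  shows "f \<in> borel_measurable torus_measure"
proof -
  have "f \<in> borel_measurable lebesgue" using assms by (simp add: measurable_completion)
  thus ?thesis
    unfolding torus_measure_def
    using measurable_restrict_space1 by (subst measurable_cong_sets[OF sets_scale_measure refl]) blast
qed

text \<open>A Borel integrand has the same integral for the completed measure as for
  \<open>lborel\<close>, where the product formula applies.\<close>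

lemma nn_integral_torus_measure:
  fixes f :: "real ^ 'n \<Rightarrow> ennreal"
  assumes "f \<in> borel_measurable borel"
  shows "(\<integral>\<^sup>+ \<psi>. f \<psi> \<partial>torus_measure) =
    ennreal (1 / (2 * pi) ^ CARD('n)) * (\<integral>\<^sup>+ \<psi>. f \<psi> * indicator angle_cube \<psi> \<partial>lborel)"
proof -
  have "f \<in> borel_measurable (lebesgue_on angle_cube)"
    using borel_measurable_torus_measure[OF assms] unfolding torus_measure_def by simp
  thus ?thesis
    unfolding torus_measure_def
    by (simp add: nn_integral_scale_measure nn_integral_restrict_space[OF angle_cube_lebesgue] nn_integral_completion)
qed

definition riesz_kernel :: "complex ^ 'n \<Rightarrow> real ^ 'n \<Rightarrow> ennreal" where
  "riesz_kernel \<zeta> \<psi> = (\<Prod>i\<in>UNIV. 1 / ennreal (norm (\<zeta> $ i - cis (\<psi> $ i)) powr (1 / 2)))"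

text \<open>Densities take values in \<open>ennreal\<close> because the one built from capacity zero
  is a pointwise supremum and may be infinite.\<close>

definition density_potential :: "(real ^ 'n \<Rightarrow> ennreal) \<Rightarrow> complex ^ 'n \<Rightarrow> ennreal" where
  "density_potential G \<zeta> = (\<integral>\<^sup>+ \<psi>. riesz_kernel \<zeta> \<psi> * G \<psi> \<partial>torus_measure)"

lemma borel_measurable_one_dim_kernel [measurable]:
  "(\<lambda>t. 1 / ennreal (norm (z - cis t) powr (1 / 2))) \<in> borel_measurable borel"
proof -
  have [measurable]: "(\<lambda>t. norm (z - cis t)) \<in> borel_measurable borel"
    by (intro borel_measurable_continuous_onI continuous_intros)
  show ?thesis by measurable
qed

lemma borel_measurable_riesz_kernel: "riesz_kernel \<zeta> \<in> borel_measurable borel"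
proof -
  have "(\<lambda>\<psi>. 1 / ennreal (norm (\<zeta> $ i - cis (\<psi> $ i)) powr (1 / 2))) \<in> borel_measurable borel" for i
    by (rule measurable_compose[OF borel_measurable_vec_component borel_measurable_one_dim_kernel])
  hence "(\<lambda>\<psi>. riesz_kernel \<zeta> \<psi>) \<in> borel_measurable borel"
    unfolding riesz_kernel_def by (intro borel_measurable_prod_ennreal) auto
  thus ?thesis by simp
qed

lemmas riesz_kernel_torus [measurable] = borel_measurable_torus_measure[OF borel_measurable_riesz_kernel]

text \<open>Tonelli reduces to coordinate integrals, each bounded by the one-dimensional estimate;
  the factors \<open>2 * pi\<close> cancel the normalization.\<close>

lemma nn_integral_riesz_kernel_mult_le:
  fixes z w :: "complex ^ 'n"
  assumes "z \<in> polydisc" "w \<in> polydisc"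
  shows "(\<integral>\<^sup>+ \<psi>. riesz_kernel z \<psi> * riesz_kernel w \<psi> \<partial>torus_measure)
    \<le> ennreal (\<Prod>i\<in>UNIV. 1 + Re (elliptic_series (w $ i * cnj (z $ i))))"
proof -
  define h where "h = (\<lambda>i t. indicator {0..<2 * pi} t *
      (1 / ennreal (norm (w $ i - cis t) powr (1/2)) * (1 / ennreal (norm (z $ i - cis t) powr (1/2)))))"
  have h [measurable]: "h i \<in> borel_measurable borel" for i unfolding h_def by measurable
  define r where "r = (\<lambda>i. 1 + Re (elliptic_series (w $ i * cnj (z $ i))))"
  have n: "norm (z $ i) < 1" "norm (w $ i) < 1" for i using assms by (auto simp: polydisc_def)
  have r: "0 \<le> r i" for i using Re_elliptic_series_ge[OF n(2)[of i] n(1)[of i]] by (simp add: r_def)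
  have ind: "indicator angle_cube \<psi> = (\<Prod>i\<in>UNIV. indicator {0..<2 * pi} (\<psi> $ i) :: ennreal)" for \<psi> :: "real ^ 'n"
    by (auto simp: angle_cube_def indicator_def)
  have "(\<integral>\<^sup>+ \<psi>. riesz_kernel z \<psi> * riesz_kernel w \<psi> \<partial>torus_measure) =
      ennreal (1 / (2 * pi) ^ CARD('n)) * (\<integral>\<^sup>+ \<psi>. riesz_kernel z \<psi> * riesz_kernel w \<psi> * indicator angle_cube \<psi> \<partial>lborel)"
    by (intro nn_integral_torus_measure borel_measurable_times_ennreal borel_measurable_riesz_kernel)
  also have "(\<lambda>\<psi>. riesz_kernel z \<psi> * riesz_kernel w \<psi> * indicator angle_cube \<psi>) = (\<lambda>\<psi>. \<Prod>i\<in>UNIV. h i (\<psi> $ i))"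
    unfolding riesz_kernel_def ind h_def by (simp add: prod.distrib mult_ac)
  also have "(\<integral>\<^sup>+ \<psi>. (\<Prod>i\<in>UNIV. h i (\<psi> $ i)) \<partial>lborel) = (\<Prod>i\<in>UNIV. \<integral>\<^sup>+ t. h i t \<partial>lborel)"
    by (rule nn_integral_lborel_vec_prod[OF h])
  also have "\<dots> \<le> (\<Prod>i\<in>UNIV. ennreal (2 * pi * r i))"
    unfolding h_def r_def by (intro prod_mono_ennreal nn_integral_kernel_product_le n)
  also have "\<dots> = ennreal ((2 * pi) ^ CARD('n) * (\<Prod>i\<in>UNIV. r i))"
    using r by (subst prod_ennreal) (auto simp: prod.distrib)
  finally have "(\<integral>\<^sup>+ \<psi>. riesz_kernel z \<psi> * riesz_kernel w \<psi> \<partial>torus_measure) \<le>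
      ennreal (1 / (2 * pi) ^ CARD('n)) * ennreal ((2 * pi) ^ CARD('n) * (\<Prod>i\<in>UNIV. r i))"
    by (simp add: mult_left_mono)
  also have "\<dots> = ennreal (\<Prod>i\<in>UNIV. r i)"
    using r by (simp add: prod_nonneg flip: ennreal_mult)
  finally show ?thesis by (simp add: r_def)
qed

lemma density_potential_finite:
  assumes G: "G \<in> borel_measurable torus_measure" "(\<integral>\<^sup>+ \<psi>. (G \<psi>)\<^sup>2 \<partial>torus_measure) < \<infinity>"
    and z: "z \<in> polydisc"
  shows "density_potential G z < \<infinity>"
proof -
  have "(density_potential G z)\<^sup>2 \<le> (\<integral>\<^sup>+ \<psi>. (riesz_kernel z \<psi>)\<^sup>2 \<partial>torus_measure) * (\<integral>\<^sup>+ \<psi>. (G \<psi>)\<^sup>2 \<partial>torus_measure)"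
    unfolding density_potential_def by (intro Cauchy_Schwarz_nn_integral G riesz_kernel_torus)
  also have "\<dots> < \<infinity>"
    using nn_integral_riesz_kernel_mult_le[OF z z] G(2)
    by (auto simp: power2_eq_square ennreal_mult_less_top intro: le_less_trans)
  finally show ?thesis by (auto simp: power2_eq_square ennreal_mult_less_top less_top[symmetric])
qed

section \<open>Domination of a potential by a Dirichlet function\<close>

text \<open>Pairing with kernel vectors is point evaluation, so separating \<open>0\<close> from the
  vectors divided by the potential bounds \<open>Re f\<close> below; positivity of the potential
  permits the division.\<close>

lemma dirichlet_function_dominating_potential:
  fixes G :: "real ^ 'n \<Rightarrow> ennreal"
  assumes G [measurable]: "G \<in> borel_measurable torus_measure"
    and G_fin: "(\<integral>\<^sup>+ \<psi>. (G \<psi>)\<^sup>2 \<partial>torus_measure) < \<infinity>"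
  shows "\<exists>f\<in>dirichlet_space. \<forall>z\<in>polydisc. 0 < density_potential G z \<longrightarrow> density_potential G z \<le> ennreal (Re (f z))"
proof -
  obtain L where "L \<ge> 0" and L: "\<And>z w :: complex ^ 'n. z \<in> polydisc \<Longrightarrow> w \<in> polydisc \<Longrightarrow>
       (\<Prod>i\<in>UNIV. 1 + Re (elliptic_series (w $ i * cnj (z $ i)))) / 2
         \<le> l2_inner (kernel_vector L z) (kernel_vector L w)"
    using kernel_constant_exists by blast
  define h where "h = (\<lambda>z. enn2real (density_potential G z))"
  have h: "density_potential G z = ennreal (h z)" if "z \<in> polydisc" for z
    using density_potential_finite[OF G G_fin that] by (simp add: h_def)
  have h_nonneg: "0 \<le> h z" for z by (simp add: h_def)
  define N where "N = enn2real (\<integral>\<^sup>+ \<psi>. (G \<psi>)\<^sup>2 \<partial>torus_measure)"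
  have N: "(\<integral>\<^sup>+ \<psi>. (G \<psi>)\<^sup>2 \<partial>torus_measure) = ennreal N" "N \<ge> 0"
    using G_fin by (simp_all add: N_def)
  define v :: "complex ^ 'n \<Rightarrow> nat ^ 'n \<Rightarrow> complex" where "v = kernel_vector L"
  have v: "square_summable (v z)" if "z \<in> polydisc" for z
    unfolding v_def using that \<open>L \<ge> 0\<close> by (rule kernel_vector_square_summable)
  \<comment> \<open>A convex set containing every \<open>v z / h z\<close> with
    \<open>h z > 0\<close>; the normalization is a linear condition on the coefficients
    \<open>c\<close>, so no division occurs.\<close>
  define V where "V = {\<lambda>\<alpha>. \<Sum>z\<in>S. c z *\<^sub>R v z \<alpha> | S c. finite S \<and> S \<subseteq> polydisc \<and>
      (\<forall>z\<in>S. 0 \<le> c z) \<and> (\<Sum>z\<in>S. c z * h z) = 1}"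
  \<comment> \<open>The bound comes from \<open>1 \<le> 2 * T * N\<close>; the \<open>+ 1\<close>
    keeps the denominator positive when \<open>N = 0\<close>.\<close>
  have V_norm: "square_summable u \<and> 1 / (2 * N + 1) \<le> l2_inner u u" if "u \<in> V" for u
  proof -
    from \<open>u \<in> V\<close> obtain S c where S: "finite S" "S \<subseteq> polydisc" and c: "\<And>z. z \<in> S \<Longrightarrow> 0 \<le> c z"
      and ch: "(\<Sum>z\<in>S. c z * h z) = 1" and u: "u = (\<lambda>\<alpha>. \<Sum>z\<in>S. c z *\<^sub>R v z \<alpha>)"
      unfolding V_def by auto
    define T where "T = (\<Sum>z\<in>S. \<Sum>w\<in>S. c z * c w * l2_inner (v z) (v w))"
    have "((\<lambda>\<alpha>. (norm (u \<alpha>))\<^sup>2) has_sum T) UNIV"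
      unfolding u T_def using S v by (intro has_sum_l2_inner_finite_sum) auto
    hence sq: "square_summable u" and T: "l2_inner u u = T"
      using has_sum_norm_square[of u] has_sum_unique unfolding square_summable_def
      by (blast intro: has_sum_imp_summable)+
    \<comment> \<open>The combination of Riesz kernels with the coefficients of \<open>u\<close>. As
      these are nonnegative, comparing Gram matrices entry by entry bounds its squared norm by
      \<open>2 * T\<close>.\<close>
    define b where "b = (\<lambda>\<psi>. \<Sum>z\<in>S. ennreal (c z) * riesz_kernel z \<psi>)"
    have b [measurable]: "b \<in> borel_measurable torus_measure"
      unfolding b_def by measurable
    have "(\<integral>\<^sup>+ \<psi>. (b \<psi>)\<^sup>2 \<partial>torus_measure) =
        (\<integral>\<^sup>+ \<psi>. (\<Sum>z\<in>S. \<Sum>w\<in>S. ennreal (c z) * ennreal (c w) * (riesz_kernel z \<psi> * riesz_kernel w \<psi>)) \<partial>torus_measure)"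
      unfolding b_def power2_eq_square sum_product by (simp add: mult_ac)
    also have "\<dots> = (\<Sum>z\<in>S. \<Sum>w\<in>S. ennreal (c z) * ennreal (c w) *
        (\<integral>\<^sup>+ \<psi>. riesz_kernel z \<psi> * riesz_kernel w \<psi> \<partial>torus_measure))"
      by (simp add: nn_integral_sum nn_integral_cmult)
    also have "\<dots> \<le> (\<Sum>z\<in>S. \<Sum>w\<in>S. ennreal (2 * (c z * c w * l2_inner (v z) (v w))))"
    proof (intro sum_mono)
      fix z w assume zw: "z \<in> S" "w \<in> S"
      have "(\<integral>\<^sup>+ \<psi>. riesz_kernel z \<psi> * riesz_kernel w \<psi> \<partial>torus_measure) \<le> ennreal (2 * l2_inner (v z) (v w))"
      proof (rule order_trans[OF nn_integral_riesz_kernel_mult_le ennreal_leI])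
        show "z \<in> polydisc" "w \<in> polydisc" using zw S by auto
        from L[OF this] show "(\<Prod>i\<in>UNIV. 1 + Re (elliptic_series (w $ i * cnj (z $ i)))) \<le> 2 * l2_inner (v z) (v w)"
          by (simp add: v_def)
      qed
      hence "ennreal (c z) * ennreal (c w) * (\<integral>\<^sup>+ \<psi>. riesz_kernel z \<psi> * riesz_kernel w \<psi> \<partial>torus_measure)
         \<le> ennreal (c z) * ennreal (c w) * ennreal (2 * l2_inner (v z) (v w))"
        by (rule mult_left_mono) simp
      also have "\<dots> = ennreal (2 * (c z * c w * l2_inner (v z) (v w)))"
        using c[OF zw(1)] c[OF zw(2)] by (simp add: mult_ac flip: ennreal_mult' ennreal_mult'')
      finally show "ennreal (c z) * ennreal (c w) * (\<integral>\<^sup>+ \<psi>. riesz_kernel z \<psi> * riesz_kernel w \<psi> \<partial>torus_measure)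
         \<le> ennreal (2 * (c z * c w * l2_inner (v z) (v w)))" .
    qed
    also have "\<dots> = ennreal (2 * T)"
    proof -
      have nn: "0 \<le> 2 * (c z * c w * l2_inner (v z) (v w))" if zw: "z \<in> S" "w \<in> S" for z w
      proof -
        have "0 \<le> (\<Prod>i\<in>UNIV. 1 + Re (elliptic_series (w $ i * cnj (z $ i)))) / 2"
        proof (intro divide_nonneg_pos prod_nonneg ballI)
          fix i
          have "-1 \<le> Re (elliptic_series (w $ i * cnj (z $ i)))"
            using zw S by (intro Re_elliptic_series_ge) (auto simp: polydisc_def)
          thus "0 \<le> 1 + Re (elliptic_series (w $ i * cnj (z $ i)))" by simp
        qed simp
        also have "\<dots> \<le> l2_inner (v z) (v w)" unfolding v_def using zw S by (intro L) auto
        finally show ?thesis using c zw by simp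
      qed
      show ?thesis
        unfolding T_def sum_distrib_left using nn by (simp add: sum_ennreal sum_nonneg)
    qed
    finally have b2: "(\<integral>\<^sup>+ \<psi>. (b \<psi>)\<^sup>2 \<partial>torus_measure) \<le> ennreal (2 * T)" .
    have "T \<ge> 0" using l2_inner_self_nonneg[of u] by (simp add: T)
    have "(\<integral>\<^sup>+ \<psi>. b \<psi> * G \<psi> \<partial>torus_measure) = (\<Sum>z\<in>S. ennreal (c z) * density_potential G z)"
      unfolding b_def density_potential_def
      by (simp add: sum_distrib_right mult.assoc nn_integral_sum nn_integral_cmult)
    also have "\<dots> = (\<Sum>z\<in>S. ennreal (c z * h z))"
      using S c h_nonneg by (intro sum.cong refl) (auto simp: h ennreal_mult)
    also have "\<dots> = 1"
      using c h_nonneg ch by (simp add: sum_ennreal)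
    \<comment> \<open>The pairing of \<open>b\<close> with \<open>G\<close> equals the normalization
      \<open>1\<close>, so Cauchy-Schwarz bounds \<open>T\<close> from below.\<close>
    finally have "1 \<le> (\<integral>\<^sup>+ \<psi>. (b \<psi>)\<^sup>2 \<partial>torus_measure) * (\<integral>\<^sup>+ \<psi>. (G \<psi>)\<^sup>2 \<partial>torus_measure)"
      using Cauchy_Schwarz_nn_integral[OF b G] by simp
    also have "\<dots> \<le> ennreal (2 * T) * ennreal N"
      unfolding N using b2 by (rule mult_right_mono) simp
    finally have "1 \<le> 2 * T * N" using N(2) \<open>T \<ge> 0\<close> by (simp flip: ennreal_mult)
    also have "\<dots> \<le> T * (2 * N + 1)" using \<open>T \<ge> 0\<close> by (simp add: algebra_simps)
    finally show ?thesis using sq T N(2) by (simp add: divide_le_eq)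
  qed
  have V_convex: "(\<lambda>\<alpha>. (1 - t) *\<^sub>R u \<alpha> + t *\<^sub>R u' \<alpha>) \<in> V" if "u \<in> V" "u' \<in> V" and t: "0 \<le> t" "t \<le> 1" for u u' t
  proof -
    from \<open>u \<in> V\<close> obtain S c where S: "finite S" "S \<subseteq> polydisc" and c: "\<And>z. z \<in> S \<Longrightarrow> 0 \<le> c z"
      and ch: "(\<Sum>z\<in>S. c z * h z) = 1" and u: "u = (\<lambda>\<alpha>. \<Sum>z\<in>S. c z *\<^sub>R v z \<alpha>)"
      unfolding V_def by auto
    from \<open>u' \<in> V\<close> obtain S' c' where S': "finite S'" "S' \<subseteq> polydisc" and c': "\<And>z. z \<in> S' \<Longrightarrow> 0 \<le> c' z"
      and ch': "(\<Sum>z\<in>S'. c' z * h z) = 1" and u': "u' = (\<lambda>\<alpha>. \<Sum>z\<in>S'. c' z *\<^sub>R v z \<alpha>)"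
      unfolding V_def by auto
    \<comment> \<open>Coefficients are extended by zero to \<open>S \<union> S'\<close>. The
      identities below hold for any vector-valued \<open>k\<close>, since they serve both the
      vectors \<open>v\<close> and the scalars \<open>h\<close>.\<close>
    define d where "d = (\<lambda>z. (1 - t) * (if z \<in> S then c z else 0) + t * (if z \<in> S' then c' z else 0))"
    have ext: "(\<Sum>z\<in>S \<union> S'. (if z \<in> S then c z else 0) *\<^sub>R k z) = (\<Sum>z\<in>S. c z *\<^sub>R k z)"
      "(\<Sum>z\<in>S \<union> S'. (if z \<in> S' then c' z else 0) *\<^sub>R k z) = (\<Sum>z\<in>S'. c' z *\<^sub>R k z)"
      for k :: "complex ^ 'n \<Rightarrow> 'b::real_vector"
      using S(1) S'(1) by (auto intro!: sum.mono_neutral_cong_right)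
    have d: "(\<Sum>z\<in>S \<union> S'. d z *\<^sub>R k z) = (1 - t) *\<^sub>R (\<Sum>z\<in>S. c z *\<^sub>R k z) + t *\<^sub>R (\<Sum>z\<in>S'. c' z *\<^sub>R k z)"
      for k :: "complex ^ 'n \<Rightarrow> 'b::real_vector"
      unfolding ext[symmetric] d_def by (simp only: scaleR_add_left sum.distrib scaleR_sum_right scaleR_scaleR)
    show ?thesis
      unfolding V_def mem_Collect_eq
    proof (intro exI conjI)
      show "(\<lambda>\<alpha>. (1 - t) *\<^sub>R u \<alpha> + t *\<^sub>R u' \<alpha>) = (\<lambda>\<alpha>. \<Sum>z\<in>S \<union> S'. d z *\<^sub>R v z \<alpha>)"
        by (simp only: d u u')
      show "finite (S \<union> S')" "S \<union> S' \<subseteq> polydisc" using S S' by auto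
      show "\<forall>z\<in>S \<union> S'. 0 \<le> d z" using c c' t by (auto simp: d_def)
      show "(\<Sum>z\<in>S \<union> S'. d z * h z) = 1" using d[of h] ch ch' by simp
    qed
  qed
  obtain x where x: "square_summable x" and xV: "\<And>u. u \<in> V \<Longrightarrow> 1 \<le> l2_inner x u"
    using convex_l2_separation[of V "1 / (2 * N + 1)"] V_norm V_convex N(2) by fastforce
  \<comment> \<open>Moving the square root of the weight from the kernel vector to \<open>x\<close>
    turns the pairing into a power series in \<open>z\<close>.\<close>
  define a where "a = (\<lambda>\<alpha>. x \<alpha> * of_real (sqrt (kernel_weight L \<alpha>)))"
  define f where "f = (\<lambda>z. \<Sum>\<^sub>\<infinity>\<alpha>. a \<alpha> * (\<Prod>i\<in>UNIV. z $ i ^ (\<alpha> $ i)))"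
  have a_v: "a \<alpha> * (\<Prod>i\<in>UNIV. z $ i ^ (\<alpha> $ i)) = x \<alpha> * cnj (v z \<alpha>)" for \<alpha> z
    by (simp add: a_def v_def kernel_vector_def)
  have f: "((\<lambda>\<alpha>. a \<alpha> * (\<Prod>i\<in>UNIV. z $ i ^ (\<alpha> $ i))) has_sum f z) UNIV" if "z \<in> polydisc" for z
  proof -
    have "square_summable (\<lambda>\<alpha>. norm (x \<alpha>))" "square_summable (\<lambda>\<alpha>. norm (v z \<alpha>))"
      using x v[OF that] by (simp_all add: square_summable_def)
    from square_summable_inner_abs_summable[OF this]
    have "(\<lambda>\<alpha>. norm (a \<alpha> * (\<Prod>i\<in>UNIV. z $ i ^ (\<alpha> $ i)))) summable_on UNIV"
      unfolding a_v by (simp add: norm_mult)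
    from has_sum_infsum[OF abs_summable_summable[OF this]] show ?thesis by (simp only: f_def)
  qed
  have Re_f: "Re (f z) = l2_inner x (v z)" if "z \<in> polydisc" for z
  proof -
    have "((\<lambda>\<alpha>. Re (x \<alpha> * cnj (v z \<alpha>))) has_sum Re (f z)) UNIV"
      using has_sum_Re[OF f[OF that]] by (simp only: a_v)
    moreover have "Re (x \<alpha> * cnj (v z \<alpha>)) = x \<alpha> \<bullet> v z \<alpha>" for \<alpha>
      by (simp add: inner_complex_def)
    ultimately show ?thesis unfolding l2_inner_def by (simp add: infsumI)
  qed
  show ?thesis
  proof (intro bexI ballI impI)
    show "f \<in> dirichlet_space"
      unfolding dirichlet_space_def mem_Collect_eq
    proof (intro exI[of _ a] conjI ballI f)
      show "(\<lambda>\<alpha>. (\<Prod>i\<in>UNIV. real (\<alpha> $ i) + 1) * (norm (a \<alpha>))\<^sup>2) summable_on UNIV"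
      \<comment> \<open>The weight in \<open>norm (a \<alpha>)\<close> squared compensates the
        Dirichlet weight: each factor \<open>(m + 1) * kernel_coeff L m\<close> is at most
        \<open>L + 1\<close>.\<close>
      proof (rule summable_on_comparison_test)
        show "(\<lambda>\<alpha>. (L + 1) ^ CARD('n) * (norm (x \<alpha>))\<^sup>2) summable_on UNIV"
          using x unfolding square_summable_def by (rule summable_on_cmult_right)
        fix \<alpha> :: "nat ^ 'n"
        have "(\<Prod>i\<in>UNIV. real (\<alpha> $ i) + 1) * (norm (a \<alpha>))\<^sup>2 =
            (\<Prod>i\<in>UNIV. (real (\<alpha> $ i) + 1) * kernel_coeff L (\<alpha> $ i)) * (norm (x \<alpha>))\<^sup>2"
          using kernel_weight_pos[OF \<open>L \<ge> 0\<close>, of \<alpha>]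
          by (simp add: a_def norm_mult power_mult_distrib prod.distrib flip: kernel_weight_def)
        also have "\<dots> \<le> (\<Prod>i\<in>(UNIV::'n set). L + 1) * (norm (x \<alpha>))\<^sup>2"
          using kernel_coeff_le[OF \<open>L \<ge> 0\<close>] kernel_coeff_pos[OF \<open>L \<ge> 0\<close>]
          by (intro mult_right_mono prod_mono) (auto simp: less_imp_le)
        finally show "(\<Prod>i\<in>UNIV. real (\<alpha> $ i) + 1) * (norm (a \<alpha>))\<^sup>2 \<le> (L + 1) ^ CARD('n) * (norm (x \<alpha>))\<^sup>2"
          by simp
        show "0 \<le> (\<Prod>i\<in>UNIV. real (\<alpha> $ i) + 1) * (norm (a \<alpha>))\<^sup>2"
          by (intro mult_nonneg_nonneg prod_nonneg) auto
      qed
    qed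
  next
    fix z assume z: "z \<in> polydisc" and "0 < density_potential G z"
    hence "h z > 0" using h[OF z] by (simp add: ennreal_less_zero_iff)
    \<comment> \<open>The separation inequality is read off at the single normalized kernel vector
      of \<open>z\<close>.\<close>
    hence "(\<lambda>\<alpha>. \<Sum>z\<in>{z}. (1 / h z) *\<^sub>R v z \<alpha>) \<in> V"
      unfolding V_def mem_Collect_eq using z by (intro exI[of _ "{z}"] exI[of _ "\<lambda>z. 1 / h z"]) auto
    hence "1 \<le> l2_inner x (\<lambda>\<alpha>. (1 / h z) *\<^sub>R v z \<alpha>)" using xV by simp
    also have "\<dots> = l2_inner x (v z) / h z"
      using has_sum_cmult_right[OF has_sum_l2_inner[OF x v[OF z]], of "1 / h z"]
      unfolding l2_inner_def[of x "\<lambda>\<alpha>. (1 / h z) *\<^sub>R v z \<alpha>"] by (intro infsumI) simp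
    finally have "h z \<le> Re (f z)" using \<open>h z > 0\<close> Re_f[OF z] by simp
    thus "density_potential G z \<le> ennreal (Re (f z))" by (simp add: h[OF z] ennreal_leI)
  qed
qed


section \<open>Lower semicontinuity of potentials and sets of capacity zero\<close>

text \<open>In \<open>ennreal\<close> the kernel is continuous even at its poles, where it is
  infinite. Its being nonzero matters because multiplication in \<open>ennreal\<close> is
  discontinuous at \<open>0\<close> times infinity.\<close>

lemma tendsto_riesz_kernel:
  fixes \<zeta> :: "complex ^ 'n"
  assumes z: "z \<longlonglongrightarrow> \<zeta>"
  shows "(\<lambda>m. riesz_kernel (z m) \<psi>) \<longlonglongrightarrow> riesz_kernel \<zeta> \<psi>" and "riesz_kernel \<zeta> \<psi> \<noteq> 0"
proof -
  define k where "k = (\<lambda>z i. 1 / ennreal (norm ((z :: complex ^ 'n) $ i - cis (\<psi> $ i)) powr (1 / 2)))"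
  have k_lim: "(\<lambda>m. k (z m) i) \<longlonglongrightarrow> k \<zeta> i" for i
  proof -
    have "(\<lambda>m. ennreal (norm (z m $ i - cis (\<psi> $ i)) powr (1 / 2))) \<longlonglongrightarrow> ennreal (norm (\<zeta> $ i - cis (\<psi> $ i)) powr (1 / 2))"
      unfolding powr_half_sqrt[OF norm_ge_zero] by (intro tendsto_ennrealI tendsto_intros z)
    hence "(\<lambda>m. inverse (ennreal (norm (z m $ i - cis (\<psi> $ i)) powr (1 / 2)))) \<longlonglongrightarrow>
        inverse (ennreal (norm (\<zeta> $ i - cis (\<psi> $ i)) powr (1 / 2)))"
      by (rule continuous_on_tendsto_compose[OF continuous_on_inverse_ennreal[OF continuous_on_id[of UNIV]]]) auto
    thus ?thesis by (simp add: k_def divide_ennreal_def)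
  qed
  have "(\<lambda>m. \<Prod>i\<in>I. k (z m) i) \<longlonglongrightarrow> (\<Prod>i\<in>I. k \<zeta> i) \<and> (\<Prod>i\<in>I. k \<zeta> i) \<noteq> 0" if "finite I" for I
    using that
  proof (induction I)
    case (insert j I)
    have "k \<zeta> j \<noteq> 0" by (simp add: k_def)
    thus ?case
      using insert by (auto intro!: tendsto_mult_ennreal k_lim)
  qed simp
  from this[of UNIV] show "(\<lambda>m. riesz_kernel (z m) \<psi>) \<longlonglongrightarrow> riesz_kernel \<zeta> \<psi>" "riesz_kernel \<zeta> \<psi> \<noteq> 0"
    by (simp_all add: riesz_kernel_def k_def)
qed

lemma density_potential_lower_semicontinuous:
  assumes G [measurable]: "G \<in> borel_measurable torus_measure" and z: "z \<longlonglongrightarrow> \<zeta>"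
  shows "density_potential G \<zeta> \<le> liminf (\<lambda>m. density_potential G (z m))"
proof -
  have "(\<lambda>m. riesz_kernel (z m) \<psi> * G \<psi>) \<longlonglongrightarrow> riesz_kernel \<zeta> \<psi> * G \<psi>" for \<psi>
  \<comment> \<open>Where \<open>G\<close> vanishes the products are constantly \<open>0\<close>,
    even against an infinite kernel; elsewhere both limits are nonzero and may be
    multiplied.\<close>
  proof (cases "G \<psi> = 0")
    case False
    thus ?thesis
      using tendsto_riesz_kernel[OF z, of \<psi>] by (intro tendsto_mult_ennreal tendsto_const) auto
  qed simp
  hence "liminf (\<lambda>m. riesz_kernel (z m) \<psi> * G \<psi>) = riesz_kernel \<zeta> \<psi> * G \<psi>" for \<psi>
    by (intro lim_imp_Liminf) auto
  hence "density_potential G \<zeta> = (\<integral>\<^sup>+ \<psi>. liminf (\<lambda>m. riesz_kernel (z m) \<psi> * G \<psi>) \<partial>torus_measure)"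
    by (simp add: density_potential_def)
  also have "\<dots> \<le> liminf (\<lambda>m. density_potential G (z m))"
    unfolding density_potential_def by (intro nn_integral_liminf) measurable
  finally show ?thesis .
qed

text \<open>The squared supremum is the supremum of all \<open>a i * a j\<close>, and each of these
  is at most the square of its larger factor, a term of the series.\<close>

lemma SUP_square_le_suminf_ennreal:
  fixes a :: "nat \<Rightarrow> ennreal"
  shows "(SUP k. a k)\<^sup>2 \<le> (\<Sum>k. (a k)\<^sup>2)"
proof -
  have le: "(a k)\<^sup>2 \<le> (\<Sum>k. (a k)\<^sup>2)" for k
    using sum_le_suminf[of "\<lambda>k. (a k)\<^sup>2" "{k}"] by simp
  have "a i * a j \<le> (\<Sum>k. (a k)\<^sup>2)" for i j
  proof (cases "a i \<le> a j")
    case True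
    hence "a i * a j \<le> (a j)\<^sup>2" unfolding power2_eq_square by (rule mult_right_mono) simp
    thus ?thesis using le order_trans by blast
  next
    case False
    hence "a i * a j \<le> (a i)\<^sup>2" unfolding power2_eq_square by (intro mult_left_mono) auto
    thus ?thesis using le order_trans by blast
  qed
  thus ?thesis
    unfolding power2_eq_square SUP_mult_left_ennreal SUP_mult_right_ennreal
    by (intro SUP_least) (simp add: power2_eq_square)
qed

text \<open>Competitors \<open>g k\<close> of rapidly decreasing norm are combined by a supremum:
  \<open>G \<ge> k * g k\<close> makes the potential at least \<open>k\<close> on \<open>E\<close>
  for every \<open>k\<close>, while the sum of the squared norms stays finite.\<close>

lemma capacity_zero_infinite_potential:
  fixes E :: "(complex ^ 'n) set"
  assumes "capacity E = 0"
  obtains G :: "real ^ 'n \<Rightarrow> ennreal" where "G \<in> borel_measurable torus_measure"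
    "(\<integral>\<^sup>+ \<psi>. (G \<psi>)\<^sup>2 \<partial>torus_measure) < \<infinity>" "\<And>\<zeta>. \<zeta> \<in> E \<Longrightarrow> density_potential G \<zeta> = \<infinity>"
proof -
  \<comment> \<open>The factor \<open>(k + 1)^2\<close> absorbs the \<open>k^2\<close> from squaring
    \<open>k * g k\<close> and leaves the geometric term; the shift keeps the denominator nonzero at
    \<open>k = 0\<close>.\<close>
  define \<epsilon> where "\<epsilon> = (\<lambda>k::nat. (1 / 2) ^ k / (real k + 1)\<^sup>2)"
  have "\<exists>g \<in> borel_measurable torus_measure. (\<integral>\<^sup>+ \<psi>. ennreal ((g \<psi>)\<^sup>2) \<partial>torus_measure) < ennreal (\<epsilon> k) \<and>
      (\<forall>\<zeta>\<in>E. 1 \<le> potential g \<zeta>)" for k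
  proof -
    have "capacity E < ennreal (\<epsilon> k)" using assms by (simp add: \<epsilon>_def)
    thus ?thesis unfolding capacity_def Inf_less_iff by blast
  qed
  then obtain g where g [measurable]: "\<And>k. g k \<in> borel_measurable torus_measure"
    and g_small: "\<And>k. (\<integral>\<^sup>+ \<psi>. ennreal ((g k \<psi>)\<^sup>2) \<partial>torus_measure) < ennreal (\<epsilon> k)"
    and g_pot: "\<And>k \<zeta>. \<zeta> \<in> E \<Longrightarrow> 1 \<le> potential (g k) \<zeta>"
    by metis
  define a where "a = (\<lambda>k \<psi>. of_nat k * ennreal (g k \<psi>))"
  have a [measurable]: "a k \<in> borel_measurable torus_measure" for k unfolding a_def by measurable
  define G where "G = (\<lambda>\<psi>. SUP k. a k \<psi>)"
  have G [measurable]: "G \<in> borel_measurable torus_measure" unfolding G_def by measurable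
  have a_int: "(\<integral>\<^sup>+ \<psi>. (a k \<psi>)\<^sup>2 \<partial>torus_measure) \<le> ennreal ((1 / 2) ^ k)" for k
  proof -
    have "(\<integral>\<^sup>+ \<psi>. (a k \<psi>)\<^sup>2 \<partial>torus_measure) \<le> (\<integral>\<^sup>+ \<psi>. ennreal ((real k)\<^sup>2) * ennreal ((g k \<psi>)\<^sup>2) \<partial>torus_measure)"
    proof (rule nn_integral_mono)
      fix \<psi>
      \<comment> \<open>Only an inequality, because \<open>ennreal\<close> sends negative reals to
        \<open>0\<close>.\<close>
      have "(ennreal r)\<^sup>2 \<le> ennreal (r\<^sup>2)" for r
        by (cases "r \<ge> 0") (simp_all add: ennreal_power ennreal_neg)
      hence "(ennreal (real k))\<^sup>2 * (ennreal (g k \<psi>))\<^sup>2 \<le> ennreal ((real k)\<^sup>2) * ennreal ((g k \<psi>)\<^sup>2)"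
        by (intro mult_mono) auto
      thus "(a k \<psi>)\<^sup>2 \<le> ennreal ((real k)\<^sup>2) * ennreal ((g k \<psi>)\<^sup>2)"
        by (simp add: a_def power_mult_distrib ennreal_of_nat_eq_real_of_nat)
    qed
    also have "\<dots> = ennreal ((real k)\<^sup>2) * (\<integral>\<^sup>+ \<psi>. ennreal ((g k \<psi>)\<^sup>2) \<partial>torus_measure)"
      by (rule nn_integral_cmult) measurable
    also have "\<dots> \<le> ennreal ((real k)\<^sup>2) * ennreal (\<epsilon> k)"
      using g_small by (intro mult_left_mono) (auto intro: less_imp_le)
    also have "\<dots> = ennreal ((real k)\<^sup>2 * \<epsilon> k)"
      unfolding \<epsilon>_def by (rule ennreal_mult[symmetric]) auto
    also have "\<dots> \<le> ennreal ((1 / 2) ^ k)"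
    proof (rule ennreal_leI)
      have "(real k)\<^sup>2 / (real k + 1)\<^sup>2 \<le> 1" by (simp add: divide_le_eq)
      from mult_right_mono[OF this, of "(1 / 2) ^ k"] show "(real k)\<^sup>2 * \<epsilon> k \<le> (1 / 2) ^ k"
        by (simp add: \<epsilon>_def)
    qed
    finally show ?thesis .
  qed
  have "(\<integral>\<^sup>+ \<psi>. (G \<psi>)\<^sup>2 \<partial>torus_measure) \<le> (\<integral>\<^sup>+ \<psi>. (\<Sum>k. (a k \<psi>)\<^sup>2) \<partial>torus_measure)"
    unfolding G_def by (intro nn_integral_mono SUP_square_le_suminf_ennreal)
  also have "\<dots> = (\<Sum>k. \<integral>\<^sup>+ \<psi>. (a k \<psi>)\<^sup>2 \<partial>torus_measure)"
    by (rule nn_integral_suminf) measurable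
  also have "\<dots> \<le> (\<Sum>k. ennreal ((1 / 2) ^ k))"
    by (intro suminf_le a_int) auto
  also have "\<dots> = ennreal (\<Sum>k. (1 / 2) ^ k)"
    by (intro suminf_ennreal2) (auto intro: summable_geometric)
  also have "\<dots> < \<infinity>" by simp
  finally have G_fin: "(\<integral>\<^sup>+ \<psi>. (G \<psi>)\<^sup>2 \<partial>torus_measure) < \<infinity>" .
  have "density_potential G \<zeta> = \<infinity>" if "\<zeta> \<in> E" for \<zeta>
  proof -
    have "of_nat k \<le> density_potential G \<zeta>" for k
    proof -
      have "of_nat k * 1 \<le> of_nat k * potential (g k) \<zeta>"
        using g_pot[OF that] by (rule mult_left_mono) simp
      also have "\<dots> = (\<integral>\<^sup>+ \<psi>. of_nat k * (riesz_kernel \<zeta> \<psi> * ennreal (g k \<psi>)) \<partial>torus_measure)"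
        unfolding potential_def riesz_kernel_def[symmetric]
        by (rule nn_integral_cmult[symmetric]) measurable
      also have "\<dots> \<le> density_potential G \<zeta>"
        unfolding density_potential_def
      proof (rule nn_integral_mono)
        fix \<psi>
        have "a k \<psi> \<le> G \<psi>" unfolding G_def by (rule SUP_upper) simp
        hence "riesz_kernel \<zeta> \<psi> * a k \<psi> \<le> riesz_kernel \<zeta> \<psi> * G \<psi>" by (rule mult_left_mono) simp
        thus "of_nat k * (riesz_kernel \<zeta> \<psi> * ennreal (g k \<psi>)) \<le> riesz_kernel \<zeta> \<psi> * G \<psi>"
          by (simp add: a_def mult_ac)
      qed
      finally show ?thesis by simp
    qed
    hence "(SUP k. of_nat k :: ennreal) \<le> density_potential G \<zeta>" by (rule SUP_least)
    thus ?thesis by (simp add: ennreal_SUP_of_nat_eq_top top_unique)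
  qed
  with G G_fin show thesis by (rule that)
qed

theorem theorem5:
  fixes E :: "(complex ^ 'n) set"
  assumes "E \<subseteq> torus" and "compact E" and "capacity E = 0"
  shows "\<exists>f \<in> (dirichlet_space :: (complex ^ 'n \<Rightarrow> complex) set).
           \<forall>\<zeta>\<in>E. filterlim (\<lambda>z. Re (f z)) at_top (at \<zeta> within polydisc)"
proof -
  obtain G :: "real ^ 'n \<Rightarrow> ennreal" where G: "G \<in> borel_measurable torus_measure"
    and G_fin: "(\<integral>\<^sup>+ \<psi>. (G \<psi>)\<^sup>2 \<partial>torus_measure) < \<infinity>"
    and G_inf: "\<And>\<zeta>. \<zeta> \<in> E \<Longrightarrow> density_potential G \<zeta> = \<infinity>"
    using capacity_zero_infinite_potential[OF assms(3)] by blast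
  obtain f where f: "f \<in> dirichlet_space" and f_ge:
    "\<And>z. z \<in> polydisc \<Longrightarrow> 0 < density_potential G z \<Longrightarrow> density_potential G z \<le> ennreal (Re (f z))"
    using dirichlet_function_dominating_potential[OF G G_fin] by blast
  have "filterlim (\<lambda>z. Re (f z)) at_top (at \<zeta> within polydisc)" if "\<zeta> \<in> E" for \<zeta>
    unfolding filterlim_at_top
  \<comment> \<open>Fatou's lemma is sequential, so the limit is tested along arbitrary sequences of
    the polydisc converging to \<zeta>.\<close>
  proof (intro allI sequentially_imp_eventually_within impI, elim conjE)
    fix Z :: real and z :: "nat \<Rightarrow> complex ^ 'n"
    assume z: "\<forall>m. z m \<in> polydisc \<and> z m \<noteq> \<zeta>" "z \<longlonglongrightarrow> \<zeta>"
    \<comment> \<open>The maximum with \<open>0\<close> avoids the truncation of a negative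
      \<open>Z\<close> by \<open>ennreal\<close>; lying strictly above it also makes the potential
      positive, as \<open>f_ge\<close> requires.\<close>
    have "ennreal (max Z 0) < liminf (\<lambda>m. density_potential G (z m))"
      using density_potential_lower_semicontinuous[OF G z(2)] G_inf[OF that] by (simp add: top_unique)
    hence "\<forall>\<^sub>F m in sequentially. ennreal (max Z 0) < density_potential G (z m)"
      by (rule less_LiminfD)
    thus "\<forall>\<^sub>F m in sequentially. Z \<le> Re (f (z m))"
    proof eventually_elim
      case (elim m)
      hence "ennreal (max Z 0) < ennreal (Re (f (z m)))"
        using f_ge[of "z m"] z(1) by (meson le_less_trans less_le_trans zero_le)
      thus ?case by (simp add: ennreal_less_iff)
    qed
  qed
  with f show ?thesis by blast
qed

end
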